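(* Let $N$ and $X$ be finite sets, $n=|N|$, $x=|X|$. For the five sets of relations $\mathcal B(N,X)$, $\mathcal I_r(N,X)$, $\mathcal S_r(N,X)$, $\mathcal I_{lr}(N,X)$, $\mathcal S_{lr}(N,X)$, denote numbers of orbits by $b,i_r,s_r,i_{lr},s_{lr}$ respectively, with superscript $l$, $r$, $lr$ according to whether the acting group is $S_N$, $S_X$, $S_N\times S_X$ (e.g. $b^{l}(n,x)$ is the number of $S_N$-orbits on $\mathcal B(N,X)$). Then, by averaging fixed-point counts over the group (Cauchy–Frobenius–Burnside) and grouping permutations by cycle type, with sums over tuples of nonnegative integers, $$b^{l}(n,x)=\sum_{a_1+2a_2+\cdots+na_n=n}\Bigl(\prod_{d=1}^n d^{a_d}a_d!\Bigr)^{-1}2^{(a_1+\cdots+a_n)x},$$ $$b^{lr}(n,x)=\sum_{\substack{\sum_i i a_i=n\\ \sum_j j b_j=x}}\Bigl(\prod_i i^{a_i}a_i!\prod_j j^{b_j}b_j!\Bigr)^{-1}2^{\sum_{i,j}a_ib_j\gcd(i,j)},$$ $$i_r^{l}(n,x)=\sum_{a_1+2a_2+\cdots+na_n=n}\Bigl(\prod_{d} d^{a_d}a_d!\Bigr)^{-1}(1+a_1)^x,$$ $$s_r^{l}(n,x)=\sum_{a_1+2a_2+\cdots+na_n=n}\Bigl(\prod_{d} d^{a_d}a_d!\Bigr)^{-1}\bigl(2^{a_1+\cdots+a_n}-1\bigr)^x,$$ $$i_{lr}^{l}(n,x)=\sum_{a_1+2a_2+\cdots+na_n=n}\Bigl(\prod_{d}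 d^{a_d}a_d!\Bigr)^{-1}\sum_{k=0}^{\min\{a_1,x\}}\binom{a_1}{k}x^{\underline{k}}.$$ Moreover, the corresponding formulas for the $S_X$-orbit counts and the $S_N\times S_X$-orbit counts of the types $i_r,s_r,i_{lr},s_{lr}$ are obtained in the same way from the following fixed-point counts, where $\pi\in S_N$ has cycle type $(1^{a_1}\cdots n^{a_n})$ and $\sigma\in S_X$ has cycle type $(1^{b_1}\cdots x^{b_x})$: $$|\mathrm{Fix}_{\mathcal I_r}(\sigma)|=(1+n)^{b_1+\cdots+b_x},\qquad |\mathrm{Fix}_{\mathcal I_r}(\pi,\sigma)|=\prod_{k=1}^{x}\Bigl(1+\sum_{d\mid k}d\,a_d\Bigr)^{b_k},$$ $$|\mathrm{Fix}_{\mathcal S_r}(\pi)|=(2^{a_1+\cdots+a_n}-1)^{x},\qquad |\mathrm{Fix}_{\mathcal S_r}(\sigma)|=(2^{n}-1)^{b_1+\cdots+b_x},$$ $$|\mathrm{Fix}_{\mathcal I_{lr}}(\pi)|=\sum_{k=0}^{\min\{a_1,x\}}\binom{a_1}{k}x^{\underline{k}},\qquad |\mathrm{Fix}_{\mathcal I_{lr}}(\sigma)|=\sum_{k=0}^{\min\{n,b_1\}}\binom{b_1}{k}n^{\underline{k}},$$ $$|\mathrm{Fix}_{\mathcal I_{lr}}(\pi,\sigma)|=\prod_{k=0}^{\min\{n,x\}}\Bigl(\sum_{i=0}^{\min\{a_k,b_k\}}\binom{a_k}{i}\binom{b_k}{i}i!\,k^{i}\Bigr),$$ $$|\mathrm{Fix}_{\mathcal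 S_{lr}}(\pi)|=\sum_{k=0}^{r}(-1)^k\binom rk(2^{r-k}-1)^{x}\ \ (r=a_1+\cdots+a_n),\qquad |\mathrm{Fix}_{\mathcal S_{lr}}(\sigma)|=\sum_{k=0}^{n}(-1)^k\binom nk(2^{n-k}-1)^{s}\ \ (s=b_1+\cdots+b_x).$$ (These further formulas are not written out; they are in any case superseded by more usable closed formulas proved bijectively.)
   Context: $\mathcal B(N,X)$ is the set of all binary relations $R\subseteq N\times X$. $R$ is right injective (resp. right surjective) if for every $a\in X$ there is at most one (resp. at least one) $i\in N$ with $(i,a)\in R$; left injective (resp. left surjective) if for every $i\in N$ there is at most one (resp. at least one) $a\in X$ with $(i,a)\in R$. $\mathcal I_r$, $\mathcal S_r$, $\mathcal I_{lr}$, $\mathcal S_{lr}$ are the sets of right injective, right surjective, left-and-right injective, and left-and-right surjective relations. $S_N,S_X$ are the symmetric groups; $S_N\times S_X$ acts on relations by $(\pi,\sigma)\cdot R=\{(\pi(i),\sigma(a)):(i,a)\in R\}$, and $S_N$ (resp. $S_X$) acts by taking $\sigma=\mathrm{id}$ (resp. $\pi=\mathrm{id}$). Cycle type $(1^{a_1}\cdots n^{a_n})$ means exactly $a_d$ cycles of length $d$ for each $d$; put $a_d=0$ for $d=0$ or $d>n$ and $b_0=0$. $\mathrm{Fix}_{\mathcal T}(g)$ is the set of relations in $\mathcal T$ fixed by $g$. $x^{\underline{k}}=x(x-1)\cdots(x-k+1)$ with $x^{\underline{0}}=1$, and $0^0=1$. *)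

theory Defs
  imports
    Complex_Main
    "HOL-Algebra.Group_Action"
    "HOL-Combinatorics.Orbits"
begin

definition relations :: "'a set \<Rightarrow> 'b set \<Rightarrow> ('a \<times> 'b) set set" where
  "relations N X = {R. R \<subseteq> N \<times> X}"

definition right_injective :: "'a set \<Rightarrow> 'b set \<Rightarrow> ('a \<times> 'b) set \<Rightarrow> bool" where
  "right_injective N X R \<longleftrightarrow> (\<forall>c\<in>X. \<exists>\<^sub>\<le>\<^sub>1 i. i \<in> N \<and> (i, c) \<in> R)"

definition right_surjective :: "'a set \<Rightarrow> 'b set \<Rightarrow> ('a \<times> 'b) set \<Rightarrow> bool" where
  "right_surjective N X R \<longleftrightarrow> (\<forall>c\<in>X. \<exists>i\<in>N. (i, c) \<in> R)"

definition left_injective :: "'a set \<Rightarrow> 'b set \<Rightarrow> ('a \<times> 'b) set \<Rightarrow> bool" where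
  "left_injective N X R \<longleftrightarrow> (\<forall>i\<in>N. \<exists>\<^sub>\<le>\<^sub>1 c. c \<in> X \<and> (i, c) \<in> R)"

definition left_surjective :: "'a set \<Rightarrow> 'b set \<Rightarrow> ('a \<times> 'b) set \<Rightarrow> bool" where
  "left_surjective N X R \<longleftrightarrow> (\<forall>i\<in>N. \<exists>c\<in>X. (i, c) \<in> R)"

definition rel_Ir :: "'a set \<Rightarrow> 'b set \<Rightarrow> ('a \<times> 'b) set set" where
  "rel_Ir N X = {R \<in> relations N X. right_injective N X R}"

definition rel_Sr :: "'a set \<Rightarrow> 'b set \<Rightarrow> ('a \<times> 'b) set set" where
  "rel_Sr N X = {R \<in> relations N X. right_surjective N X R}"

definition rel_Ilr :: "'a set \<Rightarrow> 'b set \<Rightarrow> ('a \<times> 'b) set set" where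
  "rel_Ilr N X = {R \<in> relations N X. left_injective N X R \<and> right_injective N X R}"

definition rel_Slr :: "'a set \<Rightarrow> 'b set \<Rightarrow> ('a \<times> 'b) set set" where
  "rel_Slr N X = {R \<in> relations N X. left_surjective N X R \<and> right_surjective N X R}"

text \<open>The symmetric group of an arbitrary set; HOL-Algebra's \<open>sym_group\<close> is the
  special case of the set \<open>{1..n}\<close>.\<close>

definition Sym :: "'a set \<Rightarrow> ('a \<Rightarrow> 'a) monoid" where
  "Sym S = \<lparr>carrier = {p. p permutes S}, monoid.mult = (\<circ>), one = id\<rparr>"

text \<open>The actions are restricted to the set \<open>T\<close> of relations acted upon because the locale
  \<open>group_action\<close> works with extensional bijections.\<close>

definition act_lr :: "('a \<times> 'b) set set \<Rightarrow> ('a \<Rightarrow> 'a) \<times> ('b \<Rightarrow> 'b) \<Rightarrow> ('a \<times> 'b) set \<Rightarrow> ('a \<times> 'b) set"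
  where "act_lr T g = (\<lambda>R\<in>T. {(fst g i, snd g c) |i c. (i, c) \<in> R})"

definition act_l :: "('a \<times> 'b) set set \<Rightarrow> ('a \<Rightarrow> 'a) \<Rightarrow> ('a \<times> 'b) set \<Rightarrow> ('a \<times> 'b) set"
  where "act_l T \<pi> = act_lr T (\<pi>, id)"

definition act_r :: "('a \<times> 'b) set set \<Rightarrow> ('b \<Rightarrow> 'b) \<Rightarrow> ('a \<times> 'b) set \<Rightarrow> ('a \<times> 'b) set"
  where "act_r T \<sigma> = act_lr T (id, \<sigma>)"

definition num_orbits_l :: "'a set \<Rightarrow> ('a \<times> 'b) set set \<Rightarrow> nat" where
  "num_orbits_l N T = card (orbits (Sym N) T (act_l T))"

definition num_orbits_r :: "'b set \<Rightarrow> ('a \<times> 'b) set set \<Rightarrow> nat" where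
  "num_orbits_r X T = card (orbits (Sym X) T (act_r T))"

definition num_orbits_lr :: "'a set \<Rightarrow> 'b set \<Rightarrow> ('a \<times> 'b) set set \<Rightarrow> nat" where
  "num_orbits_lr N X T = card (orbits (Sym N \<times>\<times> Sym X) T (act_lr T))"

definition Fix_l :: "('a \<times> 'b) set set \<Rightarrow> ('a \<Rightarrow> 'a) \<Rightarrow> ('a \<times> 'b) set set" where
  "Fix_l T \<pi> = invariants T (act_l T) \<pi>"

definition Fix_r :: "('a \<times> 'b) set set \<Rightarrow> ('b \<Rightarrow> 'b) \<Rightarrow> ('a \<times> 'b) set set" where
  "Fix_r T \<sigma> = invariants T (act_r T) \<sigma>"

definition Fix_lr :: "('a \<times> 'b) set set \<Rightarrow> ('a \<Rightarrow> 'a) \<Rightarrow> ('b \<Rightarrow> 'b) \<Rightarrow> ('a \<times> 'b) set set" where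
  "Fix_lr T \<pi> \<sigma> = invariants T (act_lr T) (\<pi>, \<sigma>)"

text \<open>\<open>cycle_type S p d\<close> is the number of cycles of length \<open>d\<close> of the permutation \<open>p\<close> of \<open>S\<close>,
  fixed points being cycles of length 1. For finite \<open>S\<close> it vanishes at \<open>d = 0\<close> and at
  \<open>d > card S\<close>.\<close>

definition cycle_type :: "'a set \<Rightarrow> ('a \<Rightarrow> 'a) \<Rightarrow> nat \<Rightarrow> nat" where
  "cycle_type S p d = card {C. (\<exists>s\<in>S. C = Orbits.orbit p s) \<and> card C = d}"

text \<open>A tuple \<open>(a\<^sub>1, \<dots>, a\<^sub>n)\<close> with \<open>a\<^sub>1 + 2 a\<^sub>2 + \<dots> + n a\<^sub>n = n\<close> is encoded as a function on
  \<open>nat\<close> extended by \<open>0\<close>, so that there is exactly one function for each tuple.\<close>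

definition cycle_types :: "nat \<Rightarrow> (nat \<Rightarrow> nat) set" where
  "cycle_types n = {a. (\<forall>d. d \<notin> {1..n} \<longrightarrow> a d = 0) \<and> (\<Sum>d=1..n. d * a d) = n}"

lemma finite_cycle_types: "finite (cycle_types n)"
proof (rule finite_subset)
  show "cycle_types n \<subseteq> {a. \<forall>d. (d \<in> {1..n} \<longrightarrow> a d \<in> {..n}) \<and> (d \<notin> {1..n} \<longrightarrow> a d = 0)}"
  proof clarify
    fix a d assume a: "a \<in> cycle_types n"
    have "a d \<le> n" if d: "d \<in> {1..n}"
    proof -
      have "a d \<le> d * a d" using d by simp
      also have "\<dots> \<le> (\<Sum>d=1..n. d * a d)" by (rule member_le_sum) (use d in auto)
      finally show ?thesis using a by (simp add: cycle_types_def)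
    qed
    then show "(d \<in> {1..n} \<longrightarrow> a d \<in> {..n}) \<and> (d \<notin> {1..n} \<longrightarrow> a d = 0)"
      using a by (simp add: cycle_types_def)
  qed
  show "finite {a. \<forall>d. (d \<in> {1..n} \<longrightarrow> a d \<in> {..n}) \<and> (d \<notin> {1..n} \<longrightarrow> a d = (0::nat))}"
    by (rule finite_set_of_finite_funs) auto
qed

definition cycle_weight :: "nat \<Rightarrow> (nat \<Rightarrow> nat) \<Rightarrow> real" where
  "cycle_weight n a = inverse (\<Prod>d=1..n. real d ^ a d * fact (a d))"

definition falling_fact :: "nat \<Rightarrow> nat \<Rightarrow> real" where
  "falling_fact m k = (\<Prod>i<k. real m - real i)"

end

theory Submission
  imports Defs
begin

text \<open>
  Burnside's lemma expresses the number of orbits of a finite group as the average number of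
  fixed points. The families of relations considered here are stable under \<open>S_N \<times> S_X\<close>, and for
  the subgroups \<open>S_N\<close> and \<open>S_X\<close> the fixed points of \<open>\<pi>\<close> and of \<open>\<sigma>\<close> are those of \<open>(\<pi>, id)\<close> and
  \<open>(id, \<sigma>)\<close>. Hence everything follows from three ingredients: fixed-point counts for pairs
  \<open>(\<pi>, \<sigma>)\<close>, the fact that these depend on cycle types only, and the number of permutations with a
  given cycle type.

  The central object is a relation between \<open>N\<close> and \<open>X\<close> that is fixed by \<open>(\<pi>, \<sigma>)\<close> and is injective
  on both sides: an equivariant partial matching. Such a matching pairs cycles of \<open>\<pi>\<close> with cycles
  of \<open>\<sigma>\<close> of the same length \<open>k\<close>, in one of \<open>k\<close> ways each, so removing one cycle of \<open>\<pi>\<close> gives a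
  recursion for their number (\<open>card_matchings\<close>), both for all matchings and for the perfect ones.
  The first count is the fixed-point count of the two-sided injective relations. The second one
  carries the theory of conjugacy classes. A perfect matching is an equivariant bijection, so its
  existence shows that permutations with equal cycle types are conjugate, hence that fixed-point
  counts are class functions. Moreover, fix a model permutation \<open>f\<close> of cycle type \<open>a\<close> on a set
  \<open>T\<close> with \<open>n\<close> elements: each of the \<open>n!\<close> bijections \<open>T \<rightarrow> N\<close> transports \<open>f\<close> to exactly one
  permutation of \<open>N\<close>, and each permutation of type \<open>a\<close> arises from \<open>\<Prod>d. d ^ a d * fact (a d)\<close>
  bijections, which gives the size of the class (\<open>card_permutations_of_cycle_type\<close>).

  The other counts come from three observations. Fixed subsets are unions of cycles, and a cycle
  of length \<open>i\<close> times a cycle of length \<open>j\<close> splits into \<open>gcd i j\<close> cycles; this settles the family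
  of all relations. A relation with prescribed kind of columns is a map from \<open>X\<close> to a set of
  columns, and an equivariant map is determined by its values on representatives of the cycles of
  \<open>\<sigma>\<close>, where the value on a cycle of length \<open>k\<close> is any admissible column fixed by \<open>\<pi> ^^ k\<close>
  (\<open>card_fixed_by_columns\<close>); this settles the right injective and right surjective relations.
  Finally, the two-sided surjective relations follow from the right surjective ones by
  inclusion-exclusion over the set of cycles of \<open>\<pi>\<close> that the relation misses.
\<close>

section \<open>Cycles of a permutation of a finite set\<close>

definition cycles :: "'a set \<Rightarrow> ('a \<Rightarrow> 'a) \<Rightarrow> 'a set set" where
  "cycles S p = Orbits.orbit p ` S"

lemma cycle_type_altdef: "cycle_type S p d = card {C \<in> cycles S p. card C = d}"
  unfolding cycle_type_def cycles_def by (rule arg_cong[where f = card]) auto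

text \<open>
  Only the restriction of \<open>p\<close> to \<open>S\<close> matters. Compared with \<open>p permutes S\<close> this makes it possible
  to restrict a permutation to a union of cycles, or to form \<open>map_prod \<pi> \<sigma>\<close> on \<open>N \<times> X\<close>, without
  changing the function outside.
\<close>

locale finite_perm =
  fixes S :: "'a set" and p :: "'a \<Rightarrow> 'a"
  assumes fin: "finite S" and bij: "bij_betw p S S"
begin

abbreviation cyc :: "'a \<Rightarrow> 'a set" where "cyc s \<equiv> Orbits.orbit p s"

lemma funpow_in: "s \<in> S \<Longrightarrow> (p ^^ m) s \<in> S"
  by (induction m) (simp_all add: bij_betw_apply[OF bij])

lemma funpow_inj: "s \<in> S \<Longrightarrow> t \<in> S \<Longrightarrow> (p ^^ m) s = (p ^^ m) t \<Longrightarrow> s = t"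
  using bij_betw_imp_inj_on[OF bij_betw_funpow[OF bij, of m]] by (meson inj_onD)

lemma self_in_cycle:
  assumes s: "s \<in> S"
  shows "s \<in> cyc s"
proof -
  have "finite (range (\<lambda>m. (p ^^ m) s))"
    by (rule finite_subset[OF _ fin]) (simp add: image_subset_iff funpow_in[OF s])
  then have "\<not> inj (\<lambda>m. (p ^^ m) s)"
    using finite_imageD infinite_UNIV_nat by blast
  then obtain i j where ij: "(p ^^ i) s = (p ^^ j) s" "i < j"
    unfolding inj_def by (metis linorder_neqE_nat)
  then have "(p ^^ i) s = (p ^^ i) ((p ^^ (j - i)) s)"
    by (metis add_diff_inverse_nat comp_apply funpow_add not_less_iff_gr_or_eq)
  then have "s = (p ^^ (j - i)) s"
    using funpow_inj[OF s funpow_in[OF s]] by blast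
  then show ?thesis
    unfolding orbit_altdef using ij(2) zero_less_diff by blast
qed

lemma cycle_funpow: "s \<in> S \<Longrightarrow> cyc s = range (\<lambda>m. (p ^^ m) s)"
  by (simp add: orbit_altdef_self_in[OF self_in_cycle] full_SetCompr_eq)

lemma cycle_subset: "s \<in> S \<Longrightarrow> cyc s \<subseteq> S"
  by (simp add: cycle_funpow image_subset_iff funpow_in)

lemma cycle_eq: "s \<in> S \<Longrightarrow> t \<in> cyc s \<Longrightarrow> cyc t = cyc s"
  by (meson orbit_trans orbit_swap self_in_cycle subset_antisym subsetI)

lemma cycle_finite: "s \<in> S \<Longrightarrow> finite (cyc s)"
  using cycle_subset fin finite_subset by blast

lemma cycle_card_pos: "s \<in> S \<Longrightarrow> card (cyc s) > 0"
  unfolding card_gt_0_iff using cycle_finite self_in_cycle by blast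

lemma card_cycle_conv_dist:
  assumes "s \<in> S"
  shows "card (cyc s) = funpow_dist1 p s s"
  using orbit_conv_funpow_dist1[OF self_in_cycle[OF assms]]
    inj_on_funpow_dist1[OF self_in_cycle[OF assms]]
  by (metis card_atLeastLessThan card_image diff_zero)

lemma funpow_card_cycle: "s \<in> S \<Longrightarrow> (p ^^ card (cyc s)) s = s"
  using card_cycle_conv_dist funpow_dist1_prop self_in_cycle by metis

lemma funpow_fixed_iff:
  assumes s: "s \<in> S"
  shows "(p ^^ m) s = s \<longleftrightarrow> card (cyc s) dvd m"
proof
  let ?k = "card (cyc s)"
  assume "(p ^^ m) s = s"
  then have *: "(p ^^ (m mod ?k)) s = s"
    using funpow_mod_eq[OF funpow_card_cycle[OF s]] by metis
  have "m mod ?k < funpow_dist1 p s s"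
    using cycle_card_pos[OF s] card_cycle_conv_dist[OF s] by (metis mod_less_divisor)
  then have "m mod ?k = 0"
    using * funpow_dist1_least by (metis not_gr_zero)
  then show "?k dvd m" by auto
next
  assume "card (cyc s) dvd m"
  then have "m mod card (cyc s) = 0" by simp
  then show "(p ^^ m) s = s"
    using funpow_mod_eq[OF funpow_card_cycle[OF s], of m] by simp
qed

lemma funpow_eq_imp_mod_eq:
  assumes s: "s \<in> S" and eq: "(p ^^ i) s = (p ^^ j) s"
  shows "i mod card (cyc s) = j mod card (cyc s)"
proof -
  have "i mod card (cyc s) = j mod card (cyc s)" if "i \<le> j" "(p ^^ i) s = (p ^^ j) s" for i j
  proof -
    have "(p ^^ i) s = (p ^^ i) ((p ^^ (j - i)) s)"
      using that by (metis comp_apply funpow_add le_add_diff_inverse)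
    then have "(p ^^ (j - i)) s = s"
      using funpow_inj[OF s funpow_in[OF s]] by metis
    then have "card (cyc s) dvd j - i"
      using funpow_fixed_iff[OF s] by simp
    then show ?thesis
      using mod_eq_dvd_iff_nat[OF that(1), of "card (cyc s)"] by simp
  qed
  from this[of i j] this[of j i] show ?thesis
    using eq by (metis linear)
qed

lemma cycles_finite: "finite (cycles S p)"
  unfolding cycles_def using fin by simp

lemma Union_cycles: "\<Union>(cycles S p) = S"
proof
  show "S \<subseteq> \<Union>(cycles S p)"
    unfolding cycles_def using self_in_cycle by blast
qed (simp add: cycles_def cycle_subset UN_least)

lemma cycle_in_cycles: "C \<in> cycles S p \<Longrightarrow> s \<in> C \<Longrightarrow> s \<in> S \<and> C = cyc s"
  unfolding cycles_def using cycle_eq cycle_subset by blast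

lemma cycles_nonempty: "C \<in> cycles S p \<Longrightarrow> C \<noteq> {}"
  unfolding cycles_def using self_in_cycle by blast

lemma cycles_disjoint: "C \<in> cycles S p \<Longrightarrow> D \<in> cycles S p \<Longrightarrow> C \<noteq> D \<Longrightarrow> C \<inter> D = {}"
  using cycle_in_cycles by blast

lemma card_cycle_in_range: "C \<in> cycles S p \<Longrightarrow> card C \<in> {1..card S}"
proof -
  assume C: "C \<in> cycles S p"
  then have "C \<subseteq> S" using Union_cycles by blast
  moreover from this have "card C > 0"
    using cycles_nonempty[OF C] fin by (simp add: card_gt_0_iff finite_subset)
  ultimately show ?thesis using fin by (simp add: card_mono)
qed

text \<open>
  The elements that lie on cycles of length \<open>d\<close> form a disjoint union of these cycles. Together
  with the two summation rules below this is how counts over elements or cycles become expressions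
  in the cycle type.
\<close>

lemma card_elements_on_cycles_of_length:
  "card {s \<in> S. card (cyc s) = d} = d * cycle_type S p d"
proof -
  let ?M = "{C \<in> cycles S p. card C = d}"
  have "{s \<in> S. card (cyc s) = d} = \<Union>?M"
  proof (intro equalityI subsetI)
    fix s assume "s \<in> {s \<in> S. card (cyc s) = d}"
    then show "s \<in> \<Union>?M" using self_in_cycle unfolding cycles_def by blast
  next
    fix s assume "s \<in> \<Union>?M"
    then show "s \<in> {s \<in> S. card (cyc s) = d}" using cycle_in_cycles by blast
  qed
  moreover have "card (\<Union>?M) = (\<Sum>C\<in>?M. card C)"
    by (rule card_Union_disjoint)
      (use cycles_disjoint cycle_finite in \<open>auto simp: pairwise_def disjnt_def cycles_def\<close>)
  ultimately show ?thesis by (simp add: cycle_type_altdef)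
qed

lemma sum_over_elements:
  fixes g :: "nat \<Rightarrow> 'c::comm_semiring_1"
  shows "(\<Sum>s\<in>S. g (card (cyc s))) = (\<Sum>d=1..card S. of_nat (d * cycle_type S p d) * g d)"
proof -
  have "(\<Sum>s\<in>S. g (card (cyc s))) =
      (\<Sum>d=1..card S. \<Sum>s\<in>{s \<in> S. card (cyc s) = d}. g (card (cyc s)))"
    by (rule sum.group[symmetric]) (use fin card_cycle_in_range in \<open>auto simp: cycles_def\<close>)
  also have "\<dots> = (\<Sum>d=1..card S. \<Sum>s\<in>{s \<in> S. card (cyc s) = d}. g d)"
    by (intro sum.cong) auto
  finally show ?thesis by (simp add: card_elements_on_cycles_of_length)
qed

lemma prod_over_cycles:
  fixes g :: "nat \<Rightarrow> 'c::comm_semiring_1"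
  shows "(\<Prod>C\<in>cycles S p. g (card C)) = (\<Prod>d=1..card S. g d ^ cycle_type S p d)"
proof -
  have "(\<Prod>C\<in>cycles S p. g (card C)) =
      (\<Prod>d=1..card S. \<Prod>C\<in>{C \<in> cycles S p. card C = d}. g (card C))"
    by (rule prod.group[symmetric]) (use cycles_finite card_cycle_in_range in auto)
  also have "\<dots> = (\<Prod>d=1..card S. \<Prod>C\<in>{C \<in> cycles S p. card C = d}. g d)"
    by (intro prod.cong) auto
  finally show ?thesis by (simp add: cycle_type_altdef)
qed

lemma card_cycles: "card (cycles S p) = (\<Sum>d=1..card S. cycle_type S p d)"
proof -
  have "card (cycles S p) = (\<Sum>C\<in>cycles S p. 1)" by simp
  also have "\<dots> = (\<Sum>d=1..card S. \<Sum>C\<in>{C \<in> cycles S p. card C = d}. 1)"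
    by (rule sum.group[symmetric]) (use cycles_finite card_cycle_in_range in auto)
  finally show ?thesis by (simp add: cycle_type_altdef)
qed

text \<open>
  Giving each element the weight \<open>1 / d\<close> on a cycle of length \<open>d\<close> makes every cycle weigh 1. For
  the product permutation this form is easier to evaluate than a description of its cycles.
\<close>

lemma card_cycles_conv_sum: "real (card (cycles S p)) = (\<Sum>s\<in>S. 1 / real (card (cyc s)))"
proof -
  have "(\<Sum>s\<in>S. 1 / real (card (cyc s))) =
      (\<Sum>d=1..card S. real (d * cycle_type S p d) * (1 / real d))"
    by (rule sum_over_elements)
  also have "\<dots> = (\<Sum>d=1..card S. real (cycle_type S p d))"
    by (rule sum.cong) auto
  finally show ?thesis by (simp add: card_cycles)
qed

lemma cycle_type_outside: "d \<notin> {1..card S} \<Longrightarrow> cycle_type S p d = 0"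
proof -
  assume "d \<notin> {1..card S}"
  then have "{C \<in> cycles S p. card C = d} = {}" using card_cycle_in_range by blast
  then show ?thesis by (metis card.empty cycle_type_altdef)
qed

lemma cycle_type_in_cycle_types: "cycle_type S p \<in> cycle_types (card S)"
  using cycle_type_outside sum_over_elements[of "\<lambda>_. 1 :: nat"]
  by (simp add: cycle_types_def)

lemma fixed_subset: "A \<subseteq> S \<Longrightarrow> p ` A = A \<Longrightarrow> finite_perm A p"
  by (rule finite_perm.intro)
    (meson fin finite_subset, metis bij bij_betw_subset)

lemma image_eq_iff_closed:
  assumes "A \<subseteq> S"
  shows "p ` A = A \<longleftrightarrow> (\<forall>s\<in>A. p s \<in> A)"
proof
  assume "\<forall>s\<in>A. p s \<in> A"
  then show "p ` A = A"
    by (intro endo_inj_surj finite_subset[OF assms fin] inj_on_subset[OF bij_betw_imp_inj_on[OF bij] assms])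
      (simp add: image_subset_iff)
qed blast

lemma image_cycles:
  assumes "C \<in> cycles S p"
  shows "p ` C = C"
proof -
  obtain s where s: "s \<in> S" "C = cyc s" using assms unfolding cycles_def by blast
  then have "\<forall>t\<in>C. p t \<in> C" using orbit.step[of _ p s] by simp
  then show ?thesis using image_eq_iff_closed[OF cycle_subset] s by blast
qed

text \<open>A subset is fixed exactly if it is a union of cycles.\<close>

lemma card_fixed_subsets: "card {A. A \<subseteq> S \<and> p ` A = A} = 2 ^ card (cycles S p)"
proof -
  have "bij_betw Union (Pow (cycles S p)) {A. A \<subseteq> S \<and> p ` A = A}"
    unfolding bij_betw_def
  proof
    show "inj_on Union (Pow (cycles S p))"
    proof (rule inj_onI)
      have *: "K = {C \<in> cycles S p. C \<subseteq> \<Union>K}" if "K \<subseteq> cycles S p" for K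
      proof
        show "{C \<in> cycles S p. C \<subseteq> \<Union>K} \<subseteq> K"
        proof
          fix C assume C: "C \<in> {C \<in> cycles S p. C \<subseteq> \<Union>K}"
          then obtain s where s: "s \<in> C" using cycles_nonempty by blast
          then obtain D where D: "D \<in> K" "s \<in> D" using C by blast
          then have "C = D" using cycles_disjoint[of C D] C s that by blast
          then show "C \<in> K" using D by simp
        qed
      qed (use that in auto)
      fix K L assume "K \<in> Pow (cycles S p)" "L \<in> Pow (cycles S p)" "\<Union>K = \<Union>L"
      then show "K = L" using *[of K] *[of L] by simp
    qed
    have 1: "A \<in> Union ` Pow (cycles S p)" if "A \<subseteq> S" "p ` A = A" for A
    proof -
      interpret A: finite_perm A p using fixed_subset[OF that] .
      have "cycles A p \<subseteq> cycles S p" unfolding cycles_def using that by auto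
      then show ?thesis using A.Union_cycles by blast
    qed
    have 2: "\<Union>K \<subseteq> S" if "K \<subseteq> cycles S p" for K
      using that Union_cycles by blast
    have 3: "p ` \<Union>K = \<Union>K" if "K \<subseteq> cycles S p" for K
    proof -
      have "p ` \<Union>K = (\<Union>C\<in>K. p ` C)" by blast
      also have "\<dots> = (\<Union>C\<in>K. C)" using image_cycles that by (meson SUP_cong subsetD)
      also have "\<dots> = \<Union>K" by simp
      finally show "p ` \<Union>K = \<Union>K" .
    qed
    show "Union ` Pow (cycles S p) = {A. A \<subseteq> S \<and> p ` A = A}"
    proof (intro equalityI subsetI)
      fix A assume "A \<in> Union ` Pow (cycles S p)"
      then obtain K where "K \<subseteq> cycles S p" "A = \<Union>K" by blast
      then show "A \<in> {A. A \<subseteq> S \<and> p ` A = A}" using 2 3 by simp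
    next
      fix A assume "A \<in> {A. A \<subseteq> S \<and> p ` A = A}"
      then have "A \<subseteq> S" "p ` A = A" by blast+
      then show "A \<in> Union ` Pow (cycles S p)" by (rule 1)
    qed
  qed
  then show ?thesis
    using bij_betw_same_card card_Pow[OF cycles_finite] by metis
qed

end

lemma finite_perm_permutes: "finite S \<Longrightarrow> p permutes S \<Longrightarrow> finite_perm S p"
  by unfold_locales (auto simp: permutes_imp_bij)

lemma finite_perm_id: "finite S \<Longrightarrow> finite_perm S id"
  by unfold_locales auto

lemma cycles_id: "cycles S id = (\<lambda>s. {s}) ` S"
proof -
  have "Orbits.orbit id s = {s}" for s :: 'a
    by (simp add: orbit_eq_singleton_iff)
  then show ?thesis by (simp add: cycles_def)
qed

lemma card_cycles_id: "card (cycles S id) = card S"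
  unfolding cycles_id by (rule card_image) auto

lemma cycle_type_id: "cycle_type S id d = (if d = 1 then card S else 0)"
proof -
  have "{C \<in> cycles S id. card C = d} = (if d = 1 then cycles S id else {})"
    by (auto simp: cycles_id)
  then show ?thesis by (simp add: cycle_type_altdef card_cycles_id)
qed

lemma funpow_map_prod:
  fixes f :: "'a \<Rightarrow> 'a" and g :: "'b \<Rightarrow> 'b"
  shows "map_prod f g ^^ m = map_prod (f ^^ m) (g ^^ m)"
  by (induction m) (simp_all add: fun_eq_iff)

text \<open>The product of two permutations, acting on the pairs of which the relations consist.\<close>

locale two_perms = N: finite_perm N \<pi> + X: finite_perm X \<sigma>
  for N :: "'a set" and \<pi> and X :: "'b set" and \<sigma>
begin

sublocale NX: finite_perm "N \<times> X" "map_prod \<pi> \<sigma>"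
proof
  show "finite (N \<times> X)" using N.fin X.fin by simp
  show "bij_betw (map_prod \<pi> \<sigma>) (N \<times> X) (N \<times> X)"
    using N.bij X.bij unfolding bij_betw_def by (auto simp: map_prod_inj_on map_prod_surj_on)
qed

text \<open>A power of the product fixes \<open>(i, c)\<close> exactly if it fixes both components.\<close>

lemma card_cycle_product:
  assumes "i \<in> N" "c \<in> X"
  shows "card (NX.cyc (i, c)) = lcm (card (N.cyc i)) (card (X.cyc c))"
proof -
  have "card (NX.cyc (i, c)) dvd m \<longleftrightarrow> lcm (card (N.cyc i)) (card (X.cyc c)) dvd m" for m
    using NX.funpow_fixed_iff[of "(i, c)" m] N.funpow_fixed_iff[OF assms(1), of m]
      X.funpow_fixed_iff[OF assms(2), of m] assms
    by (simp add: funpow_map_prod)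
  then show ?thesis by (meson dvd_antisym dvd_refl)
qed

text \<open>
  By the previous lemma the product of cycles of lengths \<open>i\<close> and \<open>j\<close> consists of
  \<open>i * j / lcm i j = gcd i j\<close> cycles.
\<close>

lemma card_cycles_product:
  "card (cycles (N \<times> X) (map_prod \<pi> \<sigma>)) =
     (\<Sum>i=1..card N. \<Sum>j=1..card X. cycle_type N \<pi> i * cycle_type X \<sigma> j * gcd i j)"
proof -
  have "real (card (cycles (N \<times> X) (map_prod \<pi> \<sigma>))) =
      (\<Sum>i\<in>N. \<Sum>c\<in>X. 1 / real (lcm (card (N.cyc i)) (card (X.cyc c))))"
    unfolding NX.card_cycles_conv_sum sum.cartesian_product
    by (rule sum.cong) (auto simp: card_cycle_product)
  also have "\<dots> = (\<Sum>i\<in>N. \<Sum>j=1..card X. real (j * cycle_type X \<sigma> j) * (1 / real (lcm (card (N.cyc i)) j)))"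
    by (rule sum.cong[OF refl], rule X.sum_over_elements)
  also have "\<dots> = (\<Sum>i=1..card N. real (i * cycle_type N \<pi> i) *
      (\<Sum>j=1..card X. real (j * cycle_type X \<sigma> j) * (1 / real (lcm i j))))"
    by (rule N.sum_over_elements)
  also have "\<dots> = (\<Sum>i=1..card N. \<Sum>j=1..card X.
      real (cycle_type N \<pi> i * cycle_type X \<sigma> j * gcd i j))"
    unfolding sum_distrib_left
  proof (intro sum.cong refl)
    fix i j assume "i \<in> {1..card N}" "j \<in> {1..card X}"
    then have lcm: "real (lcm i j) \<noteq> 0" by (simp add: lcm_eq_0_iff)
    have gcd: "real i * real j = real (gcd i j) * real (lcm i j)"
      by (metis of_nat_mult prod_gcd_lcm_nat)
    have "real (i * cycle_type N \<pi> i) * (real (j * cycle_type X \<sigma> j) * (1 / real (lcm i j))) =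
        real (cycle_type N \<pi> i) * real (cycle_type X \<sigma> j) * (real i * real j) / real (lcm i j)"
      by simp
    also have "\<dots> = real (cycle_type N \<pi> i * cycle_type X \<sigma> j * gcd i j)"
      unfolding gcd using lcm by simp
    finally show "real (i * cycle_type N \<pi> i) * (real (j * cycle_type X \<sigma> j) * (1 / real (lcm i j))) =
        real (cycle_type N \<pi> i * cycle_type X \<sigma> j * gcd i j)" .
  qed
  also have "\<dots> = real (\<Sum>i=1..card N. \<Sum>j=1..card X. cycle_type N \<pi> i * cycle_type X \<sigma> j * gcd i j)"
    by simp
  finally show ?thesis unfolding of_nat_eq_iff .
qed

end

section \<open>Equivariant matchings\<close>

text \<open>
  The flag \<open>e\<close> demands a perfect matching, that is the graph of an equivariant bijection. With
  and without this demand the number satisfies the same recursion, up to the summand for an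
  unmatched cycle, so both are counted in one induction.
\<close>

definition matchings ::
  "bool \<Rightarrow> 'a set \<Rightarrow> ('a \<Rightarrow> 'a) \<Rightarrow> 'b set \<Rightarrow> ('b \<Rightarrow> 'b) \<Rightarrow> ('a \<times> 'b) set set" where
  "matchings e N \<pi> X \<sigma> = {R. R \<subseteq> N \<times> X \<and> map_prod \<pi> \<sigma> ` R = R \<and>
     single_valued R \<and> single_valued (R\<inverse>) \<and> (e \<longrightarrow> Domain R = N \<and> Range R = X)}"

text \<open>
  The number of (if \<open>e\<close>: perfect) matchings between \<open>a\<close> and \<open>b\<close> cycles of length \<open>k\<close>, where matched
  cycles can be rotated against each other in \<open>k\<close> ways. The first of the \<open>a\<close> cycles stays alone or
  is matched with one of the \<open>b\<close> cycles.
\<close>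

fun match_count :: "bool \<Rightarrow> nat \<Rightarrow> nat \<Rightarrow> nat \<Rightarrow> nat" where
  "match_count e k 0 b = (if e \<and> b > 0 then 0 else 1)"
| "match_count e k (Suc a) b =
     (if e then 0 else match_count e k a b) + k * b * match_count e k a (b - 1)"

lemma match_count_perfect: "match_count True k a b = (if a = b then k ^ a * fact a else 0)"
proof (induction a arbitrary: b)
  case (Suc a)
  show ?case by (cases b) (simp_all add: Suc algebra_simps)
qed simp

lemma match_count_partial:
  "match_count False k a b = (\<Sum>i=0..min a b. (a choose i) * (b choose i) * fact i * k ^ i)"
proof -
  have "match_count False k a b = (\<Sum>i\<le>a. (a choose i) * (b choose i) * fact i * k ^ i)"
  proof (induction a arbitrary: b)
    case (Suc a)
    let ?t = "\<lambda>a b i. (a choose i) * (b choose i) * fact i * k ^ i"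
    \<comment> \<open>Choosing the partner of one cycle first turns the summand for \<open>i\<close> into the one for
      \<open>Suc i\<close>; the remaining steps are Pascal's rule.\<close>
    have shift: "k * b * ?t a (b - 1) i = (a choose i) * (b choose Suc i) * fact (Suc i) * k ^ Suc i" for i
    proof (cases b)
      case (Suc b')
      have "(b choose Suc i) * fact (Suc i) = b * (b' choose i) * fact i"
        using Suc_times_binomial_eq[of b' i] by (simp add: Suc algebra_simps)
      then have "(a choose i) * ((b choose Suc i) * fact (Suc i)) * k ^ Suc i =
          (a choose i) * (b * (b' choose i) * fact i) * k ^ Suc i" by simp
      then show ?thesis by (simp add: Suc algebra_simps)
    qed simp
    have "(\<Sum>i\<le>Suc a. ?t (Suc a) b i) = ?t (Suc a) b 0 + (\<Sum>i\<le>a. ?t (Suc a) b (Suc i))"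
      by (rule sum.atMost_Suc_shift)
    also have "(\<Sum>i\<le>a. ?t (Suc a) b (Suc i)) =
        (\<Sum>i\<le>a. ?t a b (Suc i)) + (\<Sum>i\<le>a. (a choose i) * (b choose Suc i) * fact (Suc i) * k ^ Suc i)"
      unfolding sum.distrib[symmetric] by (intro sum.cong refl) (simp only: binomial_Suc_Suc add_mult_distrib add.commute)
    also have "?t (Suc a) b 0 + (\<dots>) = (\<Sum>i\<le>Suc a. ?t a b i) +
        (\<Sum>i\<le>a. (a choose i) * (b choose Suc i) * fact (Suc i) * k ^ Suc i)"
      unfolding sum.atMost_Suc_shift[of "?t a b"] by simp
    also have "(\<Sum>i\<le>Suc a. ?t a b i) = (\<Sum>i\<le>a. ?t a b i)" by simp
    also have "(\<Sum>i\<le>a. (a choose i) * (b choose Suc i) * fact (Suc i) * k ^ Suc i) =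
        k * b * (\<Sum>i\<le>a. ?t a (b - 1) i)"
      unfolding sum_distrib_left by (intro sum.cong refl, rule shift[symmetric])
    finally show ?case unfolding match_count.simps Suc by simp
  qed simp
  also have "\<dots> = (\<Sum>i=0..min a b. (a choose i) * (b choose i) * fact i * k ^ i)"
    by (rule sum.mono_neutral_right) auto
  finally show ?thesis .
qed

context finite_perm
begin

lemma remove_cycles:
  assumes K: "K \<subseteq> cycles S p"
  shows "finite_perm (S - \<Union>K) p" and "cycles (S - \<Union>K) p = cycles S p - K"
proof -
  have in_K: "cyc s \<in> K \<longleftrightarrow> s \<in> \<Union>K" if s: "s \<in> S" for s
  proof
    assume "s \<in> \<Union>K"
    then obtain C where "C \<in> K" "s \<in> C" by blast
    then show "cyc s \<in> K" using cycle_in_cycles[of C s] K by blast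
  qed (use self_in_cycle[OF s] in blast)
  have "\<forall>s\<in>S - \<Union>K. p s \<in> S - \<Union>K"
  proof
    fix s assume s: "s \<in> S - \<Union>K"
    then have "p s \<in> S" "cyc (p s) = cyc s"
      using funpow_in[of s 1] cycle_eq[of s "p s", OF _ orbit.base] by simp_all
    then show "p s \<in> S - \<Union>K" using in_K[of s] in_K[of "p s"] s by simp
  qed
  then have "p ` (S - \<Union>K) = S - \<Union>K" using image_eq_iff_closed[of "S - \<Union>K"] by blast
  then show "finite_perm (S - \<Union>K) p" by (intro fixed_subset) blast
  show "cycles (S - \<Union>K) p = cycles S p - K"
  proof (intro equalityI subsetI)
    fix C assume "C \<in> cycles (S - \<Union>K) p"
    then obtain s where "s \<in> S" "s \<notin> \<Union>K" "C = cyc s" unfolding cycles_def by blast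
    then show "C \<in> cycles S p - K" using in_K unfolding cycles_def by blast
  next
    fix C assume C: "C \<in> cycles S p - K"
    then obtain s where s: "s \<in> S" "C = cyc s" unfolding cycles_def by blast
    then have "s \<in> S - \<Union>K" using in_K[OF s(1)] C by blast
    then show "C \<in> cycles (S - \<Union>K) p" using s(2) unfolding cycles_def by blast
  qed
qed

lemma remove_cycle:
  assumes i: "i \<in> S"
  shows "finite_perm (S - cyc i) p"
    and "cycles (S - cyc i) p = cycles S p - {cyc i}"
    and "cycle_type (S - cyc i) p = (cycle_type S p)(card (cyc i) := cycle_type S p (card (cyc i)) - 1)"
    and "cycle_type S p (card (cyc i)) > 0"
proof -
  have Ci: "cyc i \<in> cycles S p" using i unfolding cycles_def by blast
  then have K: "{cyc i} \<subseteq> cycles S p" by blast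
  show "finite_perm (S - cyc i) p" and cyc: "cycles (S - cyc i) p = cycles S p - {cyc i}"
    using remove_cycles[OF K] by simp_all
  have fin: "finite {C \<in> cycles S p. card C = d}" for d using cycles_finite by simp
  show "cycle_type S p (card (cyc i)) > 0"
    unfolding cycle_type_altdef card_gt_0_iff using fin Ci by blast
  show "cycle_type (S - cyc i) p = (cycle_type S p)(card (cyc i) := cycle_type S p (card (cyc i)) - 1)"
  proof
    fix d
    have "{C \<in> cycles (S - cyc i) p. card C = d} =
        (if d = card (cyc i) then {C \<in> cycles S p. card C = d} - {cyc i} else {C \<in> cycles S p. card C = d})"
      unfolding cyc by auto
    then show "cycle_type (S - cyc i) p d =
        ((cycle_type S p)(card (cyc i) := cycle_type S p (card (cyc i)) - 1)) d"
      using fin Ci by (simp add: cycle_type_altdef)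
  qed
qed

end

context two_perms
begin

lemma matching_funpow:
  assumes "R \<in> matchings e N \<pi> X \<sigma>" "(i, c) \<in> R"
  shows "((\<pi> ^^ m) i, (\<sigma> ^^ m) c) \<in> R"
proof (induction m)
  case (Suc m)
  then have "map_prod \<pi> \<sigma> ((\<pi> ^^ m) i, (\<sigma> ^^ m) c) \<in> map_prod \<pi> \<sigma> ` R" by (rule imageI)
  then show ?case using assms(1) unfolding matchings_def by simp
qed (use assms in simp)

text \<open>
  Following the pair \<open>(i, c)\<close> around, injectivity on both sides makes the two components return at
  the same times.
\<close>

lemma matched_cycles_card:
  assumes R: "R \<in> matchings e N \<pi> X \<sigma>" and ic: "(i, c) \<in> R"
  shows "card (X.cyc c) = card (N.cyc i)"
proof -
  have sv: "single_valued R" "single_valued (R\<inverse>)" and "R \<subseteq> N \<times> X"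
    using R unfolding matchings_def by auto
  then have i: "i \<in> N" and c: "c \<in> X" using ic by auto
  have "(\<pi> ^^ m) i = i \<longleftrightarrow> (\<sigma> ^^ m) c = c" for m
    using matching_funpow[OF R ic, of m] ic sv unfolding single_valued_def converse_iff by metis
  then have "card (N.cyc i) dvd m \<longleftrightarrow> card (X.cyc c) dvd m" for m
    using N.funpow_fixed_iff[OF i] X.funpow_fixed_iff[OF c] by simp
  then show ?thesis by (meson dvd_antisym dvd_refl)
qed

text \<open>
  A matching that contains \<open>(i, c)\<close> contains the whole cycle \<open>Z\<close> of this pair. As the two cycles have
  the same length, \<open>Z\<close> is itself a perfect matching between them, and the rest of the relation is
  an arbitrary matching of the remaining elements.
\<close>

lemma card_matchings_through:
  assumes i: "i \<in> N" and c: "c \<in> X" and eq: "card (X.cyc c) = card (N.cyc i)"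
  shows "card {R \<in> matchings e N \<pi> X \<sigma>. (i, c) \<in> R} =
    card (matchings e (N - N.cyc i) \<pi> (X - X.cyc c) \<sigma>)"
proof -
  define Z where "Z = NX.cyc (i, c)"
  have icNX: "(i, c) \<in> N \<times> X" using i c by simp
  have Z: "Z = range (\<lambda>m. ((\<pi> ^^ m) i, (\<sigma> ^^ m) c))"
    unfolding Z_def NX.cycle_funpow[OF icNX] by (simp add: funpow_map_prod)
  have Zfix: "map_prod \<pi> \<sigma> ` Z = Z"
    unfolding Z_def by (rule NX.image_cycles) (use icNX in \<open>auto simp: cycles_def\<close>)
  have DomZ: "Domain Z = N.cyc i" and RanZ: "Range Z = X.cyc c"
    unfolding Z N.cycle_funpow[OF i] X.cycle_funpow[OF c] by auto
  have same: "(\<pi> ^^ m) i = (\<pi> ^^ m') i \<longleftrightarrow> (\<sigma> ^^ m) c = (\<sigma> ^^ m') c" for m m'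
  proof
    assume "(\<pi> ^^ m) i = (\<pi> ^^ m') i"
    then have "m mod card (X.cyc c) = m' mod card (X.cyc c)"
      unfolding eq by (rule N.funpow_eq_imp_mod_eq[OF i])
    then show "(\<sigma> ^^ m) c = (\<sigma> ^^ m') c"
      using funpow_mod_eq[OF X.funpow_card_cycle[OF c]] by metis
  next
    assume "(\<sigma> ^^ m) c = (\<sigma> ^^ m') c"
    then have "m mod card (N.cyc i) = m' mod card (N.cyc i)"
      unfolding eq[symmetric] by (rule X.funpow_eq_imp_mod_eq[OF c])
    then show "(\<pi> ^^ m) i = (\<pi> ^^ m') i"
      using funpow_mod_eq[OF N.funpow_card_cycle[OF i]] by metis
  qed
  have svZ: "single_valued Z" "single_valued (Z\<inverse>)"
    unfolding Z single_valued_def using same by auto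
  have ZNX: "Z \<subseteq> N \<times> X" unfolding Z_def by (rule NX.cycle_subset[OF icNX])
  have icZ: "(i, c) \<in> Z" unfolding Z_def by (rule NX.self_in_cycle[OF icNX])
  have "bij_betw (\<lambda>R. R - Z) {R \<in> matchings e N \<pi> X \<sigma>. (i, c) \<in> R}
      (matchings e (N - N.cyc i) \<pi> (X - X.cyc c) \<sigma>)"
  proof (rule bij_betwI[where g = "\<lambda>R. R \<union> Z"])
    have sub: "Z \<subseteq> R" if "R \<in> matchings e N \<pi> X \<sigma>" "(i, c) \<in> R" for R
      unfolding Z using matching_funpow[OF that] by blast
    show "(\<lambda>R. R - Z) \<in> {R \<in> matchings e N \<pi> X \<sigma>. (i, c) \<in> R} \<rightarrow>
        matchings e (N - N.cyc i) \<pi> (X - X.cyc c) \<sigma>"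
    proof
      fix R assume "R \<in> {R \<in> matchings e N \<pi> X \<sigma>. (i, c) \<in> R}"
      then have Rm: "R \<in> matchings e N \<pi> X \<sigma>" and ic: "(i, c) \<in> R" by auto
      then have R: "R \<subseteq> N \<times> X" "map_prod \<pi> \<sigma> ` R = R" "single_valued R" "single_valued (R\<inverse>)"
        "e \<Longrightarrow> Domain R = N" "e \<Longrightarrow> Range R = X"
        unfolding matchings_def by blast+
      have disj: "t \<notin> N.cyc i \<and> d \<notin> X.cyc c" if "(t, d) \<in> R - Z" for t d
        using that R(3,4) sub[OF Rm ic] unfolding DomZ[symmetric] RanZ[symmetric] single_valued_def by blast
      have "R - Z \<subseteq> (N - N.cyc i) \<times> (X - X.cyc c)"
      proof (rule subrelI)
        fix t d assume "(t, d) \<in> R - Z"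
        then show "(t, d) \<in> (N - N.cyc i) \<times> (X - X.cyc c)"
          using disj[of t d] subsetD[OF R(1), of "(t, d)"] by simp
      qed
      moreover have "R - Z \<subseteq> N \<times> X" using R(1) by (rule subset_trans[OF Diff_subset])
      then have "map_prod \<pi> \<sigma> ` (R - Z) = R - Z"
        using inj_on_image_set_diff[OF bij_betw_imp_inj_on[OF NX.bij] _ ZNX, of R] R(2) Zfix by simp
      moreover have "single_valued (R - Z)" "single_valued ((R - Z)\<inverse>)"
        using R(3,4) unfolding single_valued_def by blast+
      moreover have "Domain (R - Z) = N - N.cyc i \<and> Range (R - Z) = X - X.cyc c" if e: e
      proof (intro conjI equalityI subsetI)
        fix t assume "t \<in> N - N.cyc i"
        moreover from this obtain d where "(t, d) \<in> R" using R(5)[OF e] by blast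
        ultimately show "t \<in> Domain (R - Z)" using DomZ by blast
      next
        fix d assume "d \<in> X - X.cyc c"
        moreover from this obtain t where "(t, d) \<in> R" using R(6)[OF e] by blast
        ultimately show "d \<in> Range (R - Z)" using RanZ by blast
      qed (use R(1) disj in blast)+
      ultimately show "R - Z \<in> matchings e (N - N.cyc i) \<pi> (X - X.cyc c) \<sigma>"
        unfolding matchings_def by blast
    qed
    show "(\<lambda>R. R \<union> Z) \<in> matchings e (N - N.cyc i) \<pi> (X - X.cyc c) \<sigma> \<rightarrow>
        {R \<in> matchings e N \<pi> X \<sigma>. (i, c) \<in> R}"
    proof
      fix R assume "R \<in> matchings e (N - N.cyc i) \<pi> (X - X.cyc c) \<sigma>"
      then have R: "R \<subseteq> (N - N.cyc i) \<times> (X - X.cyc c)" "map_prod \<pi> \<sigma> ` R = R"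
        "single_valued R" "single_valued (R\<inverse>)"
        "e \<Longrightarrow> Domain R = N - N.cyc i" "e \<Longrightarrow> Range R = X - X.cyc c"
        unfolding matchings_def by blast+
      have "map_prod \<pi> \<sigma> ` (R \<union> Z) = R \<union> Z"
        unfolding image_Un R(2) Zfix ..
      moreover have "R \<union> Z \<subseteq> N \<times> X" using R(1) ZNX by blast
      moreover have "Domain R \<inter> Domain Z = {}" "Range R \<inter> Range Z = {}"
        unfolding DomZ RanZ using R(1) by blast+
      then have "single_valued (R \<union> Z)" "single_valued ((R \<union> Z)\<inverse>)"
        using R(3,4) svZ unfolding single_valued_def by blast+
      moreover have "Domain (R \<union> Z) = N \<and> Range (R \<union> Z) = X" if e
        unfolding Domain_Un_eq Range_Un_eq R(5)[OF that] R(6)[OF that] DomZ RanZ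
        using N.cycle_subset[OF i] X.cycle_subset[OF c] by blast
      ultimately show "R \<union> Z \<in> {R \<in> matchings e N \<pi> X \<sigma>. (i, c) \<in> R}"
        unfolding matchings_def using icZ by blast
    qed
    show "R - Z \<union> Z = R" if "R \<in> {R \<in> matchings e N \<pi> X \<sigma>. (i, c) \<in> R}" for R
      using sub that by blast
    show "(R \<union> Z) - Z = R" if "R \<in> matchings e (N - N.cyc i) \<pi> (X - X.cyc c) \<sigma>" for R
    proof -
      have "R \<inter> Z = {}" using that DomZ unfolding matchings_def by blast
      then show ?thesis by blast
    qed
  qed
  then show ?thesis by (rule bij_betw_same_card)
qed

text \<open>If \<open>i\<close> has no partner, then by equivariance no element of its cycle has one.\<close>

lemma matchings_avoiding:
  assumes i: "i \<in> N"
  shows "{R \<in> matchings e N \<pi> X \<sigma>. i \<notin> Domain R} =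
    (if e then {} else matchings e (N - N.cyc i) \<pi> X \<sigma>)"
proof (cases e)
  case False
  have "i \<notin> Domain R \<longleftrightarrow> R \<subseteq> (N - N.cyc i) \<times> X" if R: "R \<in> matchings e N \<pi> X \<sigma>" for R
  proof
    assume *: "i \<notin> Domain R"
    have "t \<notin> N.cyc i" if td: "(t, d) \<in> R" for t d
    proof
      assume "t \<in> N.cyc i"
      moreover have t: "t \<in> N" using R td unfolding matchings_def by blast
      ultimately have "i \<in> N.cyc t" using N.cycle_eq[OF i, of t] N.self_in_cycle[OF i] by blast
      then obtain m where "i = (\<pi> ^^ m) t" unfolding N.cycle_funpow[OF t] by blast
      then show False using matching_funpow[OF R td, of m] * by blast
    qed
    then show "R \<subseteq> (N - N.cyc i) \<times> X" using R unfolding matchings_def by blast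
  qed (use N.self_in_cycle[OF i] in blast)
  moreover have "R \<in> matchings e (N - N.cyc i) \<pi> X \<sigma> \<longleftrightarrow>
      R \<in> matchings e N \<pi> X \<sigma> \<and> R \<subseteq> (N - N.cyc i) \<times> X" for R
  proof -
    have "R \<subseteq> N \<times> X" if "R \<subseteq> (N - N.cyc i) \<times> X" using that by blast
    then show ?thesis unfolding matchings_def mem_Collect_eq using False by metis
  qed
  ultimately show ?thesis using False by (simp only: if_False) blast
next
  case True
  then have "i \<in> Domain R" if "R \<in> matchings e N \<pi> X \<sigma>" for R
    using that i unfolding matchings_def by simp
  then show ?thesis using True by (simp only: if_True) blast
qed

lemma finite_matchings: "finite (matchings e N \<pi> X \<sigma>)"
  by (rule finite_subset[OF _ finite_Pow_iff[THEN iffD2, OF NX.fin]]) (unfold matchings_def, blast)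

lemma card_matchings_rec:
  assumes i: "i \<in> N"
  shows "card (matchings e N \<pi> X \<sigma>) =
    (if e then 0 else card (matchings e (N - N.cyc i) \<pi> X \<sigma>)) +
    (\<Sum>c | c \<in> X \<and> card (X.cyc c) = card (N.cyc i).
       card (matchings e (N - N.cyc i) \<pi> (X - X.cyc c) \<sigma>))"
proof -
  let ?M = "matchings e N \<pi> X \<sigma>"
  let ?Y = "{c \<in> X. card (X.cyc c) = card (N.cyc i)}"
  let ?U = "\<Union>c\<in>?Y. {R \<in> ?M. (i, c) \<in> R}"
  have "c \<in> ?Y" if "R \<in> ?M" "(i, c) \<in> R" for R c
  proof -
    have "c \<in> X" using that unfolding matchings_def by blast
    then show ?thesis using matched_cycles_card[OF that] by simp
  qed
  then have split: "?M = {R \<in> ?M. i \<notin> Domain R} \<union> ?U" by blast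
  have "{R \<in> ?M. i \<notin> Domain R} \<inter> ?U = {}" by blast
  then have "card ?M = card {R \<in> ?M. i \<notin> Domain R} + card ?U"
    by (subst split, intro card_Un_disjoint finite_UN_I)
      (simp_all add: finite_matchings X.fin)
  also have "card {R \<in> ?M. i \<notin> Domain R} =
      (if e then 0 else card (matchings e (N - N.cyc i) \<pi> X \<sigma>))"
    unfolding matchings_avoiding[OF i] by (cases e) (simp_all only: if_True if_False card.empty)
  also have "card ?U = (\<Sum>c\<in>?Y. card {R \<in> ?M. (i, c) \<in> R})"
  proof (rule card_UN_disjoint)
    show "\<forall>c\<in>?Y. \<forall>d\<in>?Y. c \<noteq> d \<longrightarrow> {R \<in> ?M. (i, c) \<in> R} \<inter> {R \<in> ?M. (i, d) \<in> R} = {}"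
    proof (intro ballI impI)
      fix c d :: 'b assume "c \<noteq> d"
      then have "\<not> ((i, c) \<in> R \<and> (i, d) \<in> R)" if "R \<in> ?M" for R
        using that unfolding matchings_def single_valued_def by blast
      then show "{R \<in> ?M. (i, c) \<in> R} \<inter> {R \<in> ?M. (i, d) \<in> R} = {}" by blast
    qed
  qed (simp_all add: finite_matchings X.fin)
  also have "\<dots> = (\<Sum>c\<in>?Y. card (matchings e (N - N.cyc i) \<pi> (X - X.cyc c) \<sigma>))"
    by (rule sum.cong[OF refl], rule card_matchings_through[OF i]) blast+
  finally show ?thesis .
qed

end

text \<open>
  Induction over the number of elements of \<open>N\<close>: removing a cycle of length \<open>k\<close> affects only the factor
  for \<open>k\<close>, which changes according to the recursion for \<open>match_count\<close>, since \<open>X\<close> has \<open>k * b k\<close>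
  elements on cycles of length \<open>k\<close>. Any upper bound \<open>m\<close> for the lengths may be used, because
  the factors for unused lengths are 1; a common bound for both sets is needed to see that a perfect
  matching fails to exist when the cycle types differ.
\<close>

lemma card_matchings:
  assumes "finite_perm N \<pi>" "finite_perm X \<sigma>" "card N \<le> m" "card X \<le> m"
  shows "card (matchings e N \<pi> X \<sigma>) =
    (\<Prod>k=1..m. match_count e k (cycle_type N \<pi> k) (cycle_type X \<sigma> k))"
  using assms
proof (induction "card N" arbitrary: N X rule: less_induct)
  case less
  interpret two_perms N \<pi> X \<sigma> using less.prems by (simp add: two_perms_def)
  show ?case
  proof (cases "N = {}")
    case True
    have a: "cycle_type N \<pi> k = 0" for k
      by (simp add: True cycle_type_altdef cycles_def)
    show ?thesis
    proof (cases "e \<and> X \<noteq> {}")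
      case True
      then obtain c where c: "c \<in> X" by blast
      have k: "card (X.cyc c) \<in> {1..m}" "cycle_type X \<sigma> (card (X.cyc c)) > 0"
        using X.card_cycle_in_range[of "X.cyc c"] c X.remove_cycle(4)[OF c] less.prems(4)
        unfolding cycles_def by auto
      then have "(\<Prod>k=1..m. match_count e k (cycle_type N \<pi> k) (cycle_type X \<sigma> k)) = 0"
        using True by (intro prod_zero) (auto simp: a)
      moreover have "matchings e N \<pi> X \<sigma> = {}"
        using True \<open>N = {}\<close> unfolding matchings_def by blast
      ultimately show ?thesis by simp
    next
      case False
      have "match_count e k 0 (cycle_type X \<sigma> k) = 1" for k
      proof (cases e)
        case True
        then have "X = {}" using False by simp
        then show ?thesis by (simp add: cycle_type_altdef cycles_def)
      qed simp
      moreover have "matchings e N \<pi> X \<sigma> = {{}}"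
        using False \<open>N = {}\<close> unfolding matchings_def single_valued_def by auto
      ultimately show ?thesis by (simp add: a)
    qed
  next
    case False
    then obtain i where i: "i \<in> N" by blast
    define k where "k = card (N.cyc i)"
    define a where "a = cycle_type N \<pi>"
    define b where "b = cycle_type X \<sigma>"
    define P where "P = (\<Prod>j\<in>{1..m} - {k}. match_count e j (a j) (b j))"
    have k: "k \<in> {1..m}" using N.card_cycle_in_range[of "N.cyc i"] i less.prems(3)
      unfolding k_def cycles_def by auto
    obtain a' where a': "a k = Suc a'"
      using N.remove_cycle(4)[OF i] unfolding a_def k_def using gr0_implies_Suc by blast
    have aN: "cycle_type (N - N.cyc i) \<pi> = a(k := a')"
      using N.remove_cycle(3)[OF i] a' unfolding a_def k_def by simp
    have prod: "(\<Prod>j=1..m. match_count e j ((a(k := u)) j) ((b(k := v)) j)) = match_count e k u v * P"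
      for u v unfolding P_def
      by (subst prod.remove[OF _ k]) (auto intro!: arg_cong2[where f = "(*)"] prod.cong)
    have small: "card (N - N.cyc i) < card N"
      by (rule psubset_card_mono[OF N.fin]) (use N.self_in_cycle[OF i] i in blast)
    have le: "card (N - N.cyc i) \<le> m" using small less.prems(3) by simp
    have "card (matchings e (N - N.cyc i) \<pi> X \<sigma>) =
        (\<Prod>j=1..m. match_count e j ((a(k := a')) j) ((b(k := b k)) j))"
      using less.hyps[OF small N.remove_cycle(1)[OF i] X.finite_perm_axioms le less.prems(4)]
      unfolding aN b_def by simp
    then have 1: "card (matchings e (N - N.cyc i) \<pi> X \<sigma>) = match_count e k a' (b k) * P"
      unfolding prod .
    have 2: "card (matchings e (N - N.cyc i) \<pi> (X - X.cyc c) \<sigma>) = match_count e k a' (b k - 1) * P"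
      if c: "c \<in> X" "card (X.cyc c) = card (N.cyc i)" for c
    proof -
      have "card (X - X.cyc c) \<le> m"
        using card_mono[OF X.fin, of "X - X.cyc c"] less.prems(4) by auto
      moreover have "cycle_type (X - X.cyc c) \<sigma> = b(k := b k - 1)"
        using X.remove_cycle(3)[OF c(1)] c(2) unfolding b_def k_def by simp
      ultimately show ?thesis
        using less.hyps[OF small N.remove_cycle(1)[OF i] X.remove_cycle(1)[OF c(1)] le]
        unfolding aN by (simp only: prod)
    qed
    have "card (matchings e N \<pi> X \<sigma>) =
        (if e then 0 else match_count e k a' (b k) * P) +
        (\<Sum>c | c \<in> X \<and> card (X.cyc c) = card (N.cyc i). match_count e k a' (b k - 1) * P)"
      unfolding card_matchings_rec[OF i] 1 by (intro arg_cong2[where f = "(+)"] sum.cong refl 2) auto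
    also have "\<dots> = match_count e k (a k) (b k) * P"
      unfolding a' using X.card_elements_on_cycles_of_length[of k]
      by (simp add: k_def b_def algebra_simps)
    also have "\<dots> = (\<Prod>j=1..m. match_count e j ((a(k := a k)) j) ((b(k := b k)) j))"
      unfolding prod ..
    finally show ?thesis unfolding a_def b_def by simp
  qed
qed

section \<open>Conjugacy and the number of permutations of a given cycle type\<close>

lemma graph_matching_iff:
  assumes "two_perms N \<pi> X \<sigma>" and h: "bij_betw h N X"
  shows "map_prod \<pi> \<sigma> ` ((\<lambda>i. (i, h i)) ` N) = (\<lambda>i. (i, h i)) ` N \<longleftrightarrow> (\<forall>i\<in>N. h (\<pi> i) = \<sigma> (h i))"
proof -
  interpret two_perms N \<pi> X \<sigma> by fact
  have "(\<lambda>i. (i, h i)) ` N \<subseteq> N \<times> X" using bij_betwE[OF h] by blast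
  moreover have "\<pi> i \<in> N" if "i \<in> N" for i using bij_betwE[OF N.bij] that by blast
  ultimately show ?thesis
    using NX.image_eq_iff_closed[of "(\<lambda>i. (i, h i)) ` N"] by auto
qed

lemma perfect_matching_graph:
  assumes R: "R \<subseteq> N \<times> X" "single_valued R" "single_valued (R\<inverse>)" "Domain R = N" "Range R = X"
  obtains h where "bij_betw h N X" "R = (\<lambda>i. (i, h i)) ` N"
proof -
  have "\<forall>i\<in>N. \<exists>c. (i, c) \<in> R" using R(4) by blast
  then obtain h where h: "\<And>i. i \<in> N \<Longrightarrow> (i, h i) \<in> R" by metis
  have graph: "c = h i" if "(i, c) \<in> R" for i c
  proof -
    have "i \<in> N" using that R(1) by blast
    then show ?thesis using h that R(2) unfolding single_valued_def by blast
  qed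
  have "R = (\<lambda>i. (i, h i)) ` N"
  proof (intro equalityI subsetI)
    fix z assume z: "z \<in> R"
    then obtain i c where "z = (i, c)" "i \<in> N" using R(1) by blast
    then show "z \<in> (\<lambda>i. (i, h i)) ` N" using graph[of i c] z by blast
  qed (use h in blast)
  moreover have "bij_betw h N X"
  proof (rule bij_betw_imageI)
    show "inj_on h N"
    proof (rule inj_onI)
      fix i j assume ij: "i \<in> N" "j \<in> N" "h i = h j"
      show "i = j"
        using h[OF ij(1)] h[OF ij(2)] R(3) unfolding ij(3) single_valued_def converse_iff by blast
    qed
    show "h ` N = X"
    proof (intro equalityI subsetI)
      fix c assume "c \<in> X"
      then obtain i where i: "(i, c) \<in> R" using R(5) by blast
      then have "i \<in> N" using R(1) by blast
      then show "c \<in> h ` N" using graph[OF i] by blast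
    qed (use h R(1) in blast)
  qed
  ultimately show ?thesis using that by blast
qed

text \<open>
  For equal cycle types the number of perfect matchings is a product of positive numbers, so there
  is an equivariant bijection; extended by the identity it is the conjugating permutation.
\<close>

lemma conjugate_if_same_cycle_type:
  assumes N: "finite N" and \<pi>: "\<pi> permutes N" and \<rho>: "\<rho> permutes N"
    and eq: "cycle_type N \<pi> = cycle_type N \<rho>"
  obtains \<tau> where "\<tau> permutes N" "\<tau> \<circ> \<pi> = \<rho> \<circ> \<tau>"
proof -
  have fp: "finite_perm N \<pi>" "finite_perm N \<rho>" using finite_perm_permutes N \<pi> \<rho> by auto
  have tp: "two_perms N \<pi> N \<rho>" using fp unfolding two_perms_def by simp
  have "card (matchings True N \<pi> N \<rho>) > 0"
    unfolding card_matchings[OF fp order_refl order_refl]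
    by (rule prod_pos) (simp add: match_count_perfect eq)
  then obtain R where R: "R \<in> matchings True N \<pi> N \<rho>" by (metis card.empty equals0I less_irrefl)
  then obtain h where h: "bij_betw h N N" "R = (\<lambda>i. (i, h i)) ` N"
    using perfect_matching_graph[of R N N] unfolding matchings_def by blast
  have comm: "h (\<pi> i) = \<rho> (h i)" if "i \<in> N" for i
    using graph_matching_iff[OF tp h(1)] R that unfolding matchings_def h(2) by blast
  define \<tau> where "\<tau> = (\<lambda>i. if i \<in> N then h i else i)"
  have "bij_betw \<tau> N N" using h(1) by (rule bij_betw_cong[THEN iffD1, rotated]) (simp add: \<tau>_def)
  then have "\<tau> permutes N" by (rule bij_imp_permutes) (simp add: \<tau>_def)
  moreover have "\<tau> \<circ> \<pi> = \<rho> \<circ> \<tau>"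
  proof
    fix i show "(\<tau> \<circ> \<pi>) i = (\<rho> \<circ> \<tau>) i"
      using comm[of i] permutes_in_image[OF \<pi>, of i] permutes_not_in[OF \<pi>, of i] permutes_not_in[OF \<rho>, of i]
      by (cases "i \<in> N") (simp_all add: \<tau>_def)
  qed
  ultimately show ?thesis using that by blast
qed

text \<open>
  The triple \<open>(d, j, i)\<close> stands for the \<open>i\<close>-th position on the \<open>j\<close>-th cycle of length \<open>d\<close>.
\<close>

lemma permutation_of_cycle_type_exists:
  assumes a: "a \<in> cycle_types n"
  obtains T :: "(nat \<times> nat \<times> nat) set" and f
  where "finite_perm T f" "cycle_type T f = a" "card T = n"
proof -
  define T where "T = (SIGMA d:{1..n}. {..<a d} \<times> {..<d})"
  define f :: "nat \<times> nat \<times> nat \<Rightarrow> nat \<times> nat \<times> nat" where "f = (\<lambda>(d, j, i). (d, j, Suc i mod d))"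
  have finT: "finite T" unfolding T_def by simp
  have inj: "inj_on f T"
    unfolding f_def T_def by (auto simp: inj_on_def mod_Suc split: if_splits)
  have "f ` T \<subseteq> T" unfolding f_def T_def by auto
  then have "bij_betw f T T" using endo_inj_surj[OF finT _ inj] inj unfolding bij_betw_def by blast
  then interpret T: finite_perm T f using finT by unfold_locales
  have funpow: "(f ^^ m) (d, j, i) = (d, j, (i + m) mod d)" if "i < d" for m d j i
    by (induction m) (simp_all add: f_def that mod_Suc_eq)
  have cyc: "T.cyc (d, j, i) = (\<lambda>i. (d, j, i)) ` {..<d}" if t: "(d, j, i) \<in> T" for d j i
  proof -
    have i: "i < d" using t unfolding T_def by simp
    have "(d, j, i') \<in> range (\<lambda>m. (d, j, (i + m) mod d))" if "i' < d" for i'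
      using that i by (intro image_eqI[of _ _ "d - i + i'"]) simp_all
    then show ?thesis
      unfolding T.cycle_funpow[OF t] funpow[OF i] using i by auto
  qed
  have type: "cycle_type T f d = a d" for d
  proof (cases "d \<in> {1..n}")
    case True
    let ?g = "\<lambda>j. (\<lambda>i. (d, j, i)) ` {..<d}"
    have card_cyc: "card ((\<lambda>i. (e, j, i)) ` {..<e}) = e" for e j :: nat
      by (subst card_image) (auto simp: inj_on_def)
    have "{C \<in> cycles T f. card C = d} = ?g ` {..<a d}"
    proof (intro equalityI subsetI)
      fix C assume C: "C \<in> {C \<in> cycles T f. card C = d}"
      then obtain z where z: "z \<in> T" "C = T.cyc z" unfolding cycles_def by blast
      obtain e j i where eji: "z = (e, j, i)" by (rule prod_cases3)
      have t: "(e, j, i) \<in> T" and "C = T.cyc (e, j, i)" using z unfolding eji by simp_all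
      then have C': "C = (\<lambda>i. (e, j, i)) ` {..<e}" using cyc by simp
      then have "e = d" using C card_cyc by simp
      then show "C \<in> ?g ` {..<a d}" using t C' unfolding T_def by auto
    next
      fix C assume "C \<in> ?g ` {..<a d}"
      then obtain j where j: "j < a d" "C = ?g j" by blast
      then have t: "(d, j, 0) \<in> T" using True unfolding T_def by auto
      then have "C = T.cyc (d, j, 0)" using cyc[OF t] j by simp
      then have "C \<in> cycles T f" using t unfolding cycles_def by blast
      then show "C \<in> {C \<in> cycles T f. card C = d}" using card_cyc j by simp
    qed
    moreover have "inj_on ?g {..<a d}"
    proof (rule inj_onI)
      fix j j' assume "?g j = ?g j'"
      moreover have "(d, j, 0) \<in> ?g j" using True by auto
      ultimately show "j = j'" by auto
    qed
    ultimately show ?thesis by (simp add: cycle_type_altdef card_image)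
  next
    case False
    have "card C \<in> {1..n}" if C: "C \<in> cycles T f" for C
    proof -
      obtain z where z: "z \<in> T" "C = T.cyc z" using C unfolding cycles_def by blast
      obtain e j i where eji: "z = (e, j, i)" by (rule prod_cases3)
      have t: "(e, j, i) \<in> T" and "C = T.cyc (e, j, i)" using z unfolding eji by simp_all
      then have "card C = e" using cyc by (simp add: card_image inj_on_def)
      then show ?thesis using t unfolding T_def by auto
    qed
    then have "{C \<in> cycles T f. card C = d} = {}" using False by blast
    then have "cycle_type T f d = 0" unfolding cycle_type_altdef by (simp only: card.empty)
    then show ?thesis using False a unfolding cycle_types_def by simp
  qed
  have "card T = (\<Sum>d=1..n. d * a d)"
    unfolding T_def by (simp add: card_SigmaI mult.commute)
  then have "card T = n" using a unfolding cycle_types_def by simp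
  then show ?thesis using that T.finite_perm_axioms type by blast
qed

text \<open>
  Perfect matchings for the identity permutations are the graphs of all bijections, and the general
  formula specializes to their number.
\<close>

lemma card_perfect_matchings_id:
  assumes "finite T" "finite N" "card T = n" "card N = n"
  shows "card (matchings True T id N id) = fact n"
proof -
  have "card (matchings True T id N id) = (\<Prod>k=1..n. if k = 1 then fact n else 1)"
    unfolding card_matchings[OF finite_perm_id[OF assms(1)] finite_perm_id[OF assms(2)] eq_refl[OF assms(3)] eq_refl[OF assms(4)]]
    by (rule prod.cong) (simp_all add: match_count_perfect cycle_type_id assms(3,4))
  also have "\<dots> = fact n" by (cases "n = 0") (simp_all add: prod.delta)
  finally show ?thesis .
qed

text \<open>
  Double counting of the pairs of a permutation \<open>\<pi>\<close> of \<open>N\<close> and a bijection from the model \<open>T\<close> to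
  \<open>N\<close> that is equivariant for \<open>f\<close> and \<open>\<pi>\<close>. A bijection \<open>h\<close> belongs to one \<open>\<pi>\<close> only, its conjugate
  \<open>h \<circ> f \<circ> h\<^sup>-\<^sup>1\<close>; a permutation \<open>\<pi>\<close> belongs to \<open>Z\<close> bijections if it has the type \<open>a\<close>, and to
  none otherwise.
\<close>

lemma card_permutations_of_cycle_type:
  assumes N: "finite N" and n: "card N = n" and a: "a \<in> cycle_types n"
  shows "real (card {\<pi>. \<pi> permutes N \<and> cycle_type N \<pi> = a}) = fact n * cycle_weight n a"
proof -
  obtain T :: "(nat \<times> nat \<times> nat) set" and f where T: "finite_perm T f" "cycle_type T f = a" "card T = n"
    using permutation_of_cycle_type_exists[OF a] .
  interpret T: finite_perm T f by fact
  define P where "P = matchings True T id N id"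
  define Z where "Z = (\<Prod>d=1..n. d ^ a d * fact (a d))"
  define S where "S = {\<pi>. \<pi> permutes N}"
  have finS: "finite S" unfolding S_def using N by (rule finite_permutations)
  have finP: "finite P" unfolding P_def
    by (rule two_perms.finite_matchings) (simp add: two_perms_def finite_perm_id T.fin N)
  have fp: "finite_perm N \<pi>" if "\<pi> \<in> S" for \<pi>
    using that N finite_perm_permutes unfolding S_def by blast
  have PS: "{R \<in> P. map_prod f \<pi> ` R = R} = matchings True T f N \<pi>" for \<pi>
    unfolding P_def matchings_def map_prod.identity map_prod.id by auto
  have one: "card {\<pi> \<in> S. map_prod f \<pi> ` R = R} = 1" if R: "R \<in> P" for R
  proof -
    obtain h where h: "bij_betw h T N" "R = (\<lambda>i. (i, h i)) ` T"
      using perfect_matching_graph[of R T N] R unfolding P_def matchings_def by blast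
    have iff: "map_prod f \<pi> ` R = R \<longleftrightarrow> (\<forall>t\<in>T. h (f t) = \<pi> (h t))" if "\<pi> \<in> S" for \<pi>
      unfolding h(2) by (rule graph_matching_iff) (use fp[OF that] T(1) h(1) in \<open>simp_all add: two_perms_def\<close>)
    define \<pi>\<^sub>0 where "\<pi>\<^sub>0 = (\<lambda>s. if s \<in> N then h (f (inv_into T h s)) else s)"
    have \<pi>\<^sub>0h: "\<pi>\<^sub>0 (h t) = h (f t)" if "t \<in> T" for t
      using that bij_betwE[OF h(1)] inv_into_f_f[OF bij_betw_imp_inj_on[OF h(1)] that]
      unfolding \<pi>\<^sub>0_def by simp
    have "bij_betw (h \<circ> f \<circ> inv_into T h) N N"
      by (intro bij_betw_trans[OF bij_betw_inv_into[OF h(1)]] bij_betw_trans[OF T.bij h(1)])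
    then have "bij_betw \<pi>\<^sub>0 N N"
      by (rule bij_betw_cong[THEN iffD1, rotated]) (simp add: \<pi>\<^sub>0_def)
    then have "\<pi>\<^sub>0 permutes N" by (rule bij_imp_permutes) (simp add: \<pi>\<^sub>0_def)
    then have \<pi>\<^sub>0S: "\<pi>\<^sub>0 \<in> S" unfolding S_def by blast
    have uniq: "\<pi> = \<pi>\<^sub>0" if \<pi>: "\<pi> \<in> S" "\<forall>t\<in>T. h (f t) = \<pi> (h t)" for \<pi>
    proof
      fix s show "\<pi> s = \<pi>\<^sub>0 s"
      proof (cases "s \<in> N")
        case True
        then obtain t where "t \<in> T" "s = h t" using bij_betw_imp_surj_on[OF h(1)] by blast
        then show ?thesis using \<pi>(2) \<pi>\<^sub>0h by simp
      next
        case False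
        then show ?thesis using permutes_not_in[of \<pi> N s] \<pi>(1) unfolding \<pi>\<^sub>0_def S_def by simp
      qed
    qed
    have "{\<pi> \<in> S. map_prod f \<pi> ` R = R} = {\<pi>\<^sub>0}"
    proof (intro equalityI subsetI)
      fix \<pi> assume "\<pi> \<in> {\<pi> \<in> S. map_prod f \<pi> ` R = R}"
      then have "\<pi> \<in> S" "map_prod f \<pi> ` R = R" by (rule CollectE, simp)+
      then have "\<pi> = \<pi>\<^sub>0" using uniq[of \<pi>] iff[of \<pi>] by simp
      then show "\<pi> \<in> {\<pi>\<^sub>0}" by simp
    next
      fix \<pi> assume "\<pi> \<in> {\<pi>\<^sub>0}"
      then have "\<pi> = \<pi>\<^sub>0" by simp
      moreover have "map_prod f \<pi>\<^sub>0 ` R = R" unfolding iff[OF \<pi>\<^sub>0S] using \<pi>\<^sub>0h by simp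
      ultimately show "\<pi> \<in> {\<pi> \<in> S. map_prod f \<pi> ` R = R}" using \<pi>\<^sub>0S by blast
    qed
    then show ?thesis by simp
  qed
  have "(\<Sum>\<pi>\<in>S. card {R \<in> P. map_prod f \<pi> ` R = R}) = 1 * card P"
    by (rule sum_multicount[OF finS finP]) (use one in blast)
  then have "fact n = (\<Sum>\<pi>\<in>S. card (matchings True T f N \<pi>))"
    unfolding PS unfolding P_def card_perfect_matchings_id[OF T.fin N T(3) n] by simp
  also have "\<dots> = (\<Sum>\<pi>\<in>S. if cycle_type N \<pi> = a then Z else 0)"
  proof (rule sum.cong[OF refl])
    fix \<pi> assume \<pi>: "\<pi> \<in> S"
    interpret N: finite_perm N \<pi> by (rule fp[OF \<pi>])
    have "card (matchings True T f N \<pi>) = (\<Prod>k=1..n. match_count True k (a k) (cycle_type N \<pi> k))"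
      using card_matchings[OF T(1) fp[OF \<pi>], of n True] T(2,3) n by simp
    also have "\<dots> = (if cycle_type N \<pi> = a then Z else 0)"
    proof (cases "cycle_type N \<pi> = a")
      case False
      then obtain k where k: "cycle_type N \<pi> k \<noteq> a k" by blast
      moreover have "k \<in> {1..n}"
      proof (rule ccontr)
        assume "k \<notin> {1..n}"
        then show False using k N.cycle_type_outside[of k] a n unfolding cycle_types_def by simp
      qed
      ultimately have "(\<Prod>k=1..n. match_count True k (a k) (cycle_type N \<pi> k)) = 0"
        by (intro prod_zero bexI[of _ k]) (simp_all add: match_count_perfect)
      then show ?thesis using False by simp
    qed (simp add: Z_def match_count_perfect)
    finally show "card (matchings True T f N \<pi>) = (if cycle_type N \<pi> = a then Z else 0)" .
  qed
  also have "\<dots> = (\<Sum>\<pi>\<in>{\<pi> \<in> S. cycle_type N \<pi> = a}. Z)"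
    by (rule sum.inter_filter[OF finS, symmetric])
  also have "\<dots> = card {\<pi>. \<pi> permutes N \<and> cycle_type N \<pi> = a} * Z"
    unfolding S_def by simp
  finally have "real (fact n) = real (card {\<pi>. \<pi> permutes N \<and> cycle_type N \<pi> = a} * Z)" by simp
  moreover have "real Z \<noteq> 0" unfolding Z_def by simp
  moreover have "cycle_weight n a = inverse (real Z)"
    unfolding cycle_weight_def Z_def by simp
  ultimately show ?thesis by (simp add: field_simps)
qed

lemma sum_over_permutations:
  fixes G :: "(nat \<Rightarrow> nat) \<Rightarrow> real"
  assumes N: "finite N" and n: "card N = n"
  shows "(\<Sum>\<pi> | \<pi> permutes N. G (cycle_type N \<pi>)) = fact n * (\<Sum>a\<in>cycle_types n. cycle_weight n a * G a)"
proof -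
  have "cycle_type N ` {\<pi>. \<pi> permutes N} \<subseteq> cycle_types n"
    using finite_perm.cycle_type_in_cycle_types[OF finite_perm_permutes[OF N]] n by auto
  then have "(\<Sum>\<pi> | \<pi> permutes N. G (cycle_type N \<pi>)) =
      (\<Sum>a\<in>cycle_types n. \<Sum>\<pi>\<in>{\<pi> \<in> {\<pi>. \<pi> permutes N}. cycle_type N \<pi> = a}. G (cycle_type N \<pi>))"
    by (intro sum.group[symmetric] finite_permutations N finite_cycle_types)
  also have "\<dots> = (\<Sum>a\<in>cycle_types n. fact n * cycle_weight n a * G a)"
    by (rule sum.cong[OF refl]) (simp add: card_permutations_of_cycle_type[OF N n])
  finally show ?thesis by (simp add: sum_distrib_left mult.assoc)
qed

section \<open>Orbits on a symmetric family of relations\<close>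

lemma Fix_lr_altdef: "Fix_lr T \<pi> \<sigma> = {R \<in> T. map_prod \<pi> \<sigma> ` R = R}"
proof -
  have "act_lr T (\<pi>, \<sigma>) R = map_prod \<pi> \<sigma> ` R" if "R \<in> T" for R
    using that unfolding act_lr_def by force
  then show ?thesis unfolding Fix_lr_def invariants_def by (intro Collect_cong conj_cong refl) simp
qed

lemma Fix_l_altdef: "Fix_l T \<pi> = Fix_lr T \<pi> id"
  unfolding Fix_l_def Fix_lr_def act_l_def invariants_def ..

lemma Fix_r_altdef: "Fix_r T \<sigma> = Fix_lr T id \<sigma>"
  unfolding Fix_r_def Fix_lr_def act_r_def invariants_def ..

lemma group_Sym: "group (Sym S)"
proof (rule groupI)
  fix p assume "p \<in> carrier (Sym S)"
  then have p: "p permutes S" by (simp add: Sym_def)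
  show "\<exists>q\<in>carrier (Sym S). q \<otimes>\<^bsub>Sym S\<^esub> p = \<one>\<^bsub>Sym S\<^esub>"
    by (rule bexI[of _ "inv_into UNIV p"]) (use permutes_inv[OF p] permutes_inv_o(2)[OF p] in \<open>simp_all add: Sym_def\<close>)
qed (simp_all add: Sym_def permutes_compose permutes_id comp_assoc)

lemma order_Sym: "finite S \<Longrightarrow> order (Sym S) = fact (card S)"
  unfolding order_def Sym_def by (simp add: card_permutations)

text \<open>The properties of the five families that turn them into sets on which the groups act.\<close>

locale symmetric_family =
  fixes N :: "'a set" and X :: "'b set" and T :: "('a \<times> 'b) set set"
  assumes finN: "finite N" and finX: "finite X"
    and subsets: "T \<subseteq> relations N X"
    and closed: "\<pi> permutes N \<Longrightarrow> \<sigma> permutes X \<Longrightarrow> R \<in> T \<Longrightarrow> map_prod \<pi> \<sigma> ` R \<in> T"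
begin

lemma finite_family: "finite T"
  by (rule finite_subset[of _ "Pow (N \<times> X)"]) (use finN finX subsets in \<open>auto simp: relations_def\<close>)

lemma finite_Fix_lr: "finite (Fix_lr T \<pi> \<sigma>)"
  unfolding Fix_lr_altdef using finite_family by simp

lemma act_lr_image: "R \<in> T \<Longrightarrow> act_lr T g R = map_prod (fst g) (snd g) ` R"
  unfolding act_lr_def by force

lemma act_lr_Bij:
  assumes g: "g \<in> carrier (Sym N \<times>\<times> Sym X)"
  shows "act_lr T g \<in> Bij T"
proof -
  have p: "fst g permutes N" "snd g permutes X" using g unfolding DirProd_def Sym_def by auto
  have "inj (map_prod (fst g) (snd g))"
    using p[THEN permutes_inj] by (rule prod.inj_map)
  then have "inj_on (act_lr T g) T"
    by (intro inj_onI) (simp add: act_lr_image inj_image_eq_iff)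
  moreover have "act_lr T g ` T \<subseteq> T"
    using closed[OF p] by (simp add: image_subset_iff act_lr_image)
  ultimately have "bij_betw (act_lr T g) T T"
    using endo_inj_surj[OF finite_family] unfolding bij_betw_def by simp
  then show ?thesis unfolding Bij_def by (simp add: act_lr_def)
qed

lemma act_lr_hom: "act_lr T \<in> hom (Sym N \<times>\<times> Sym X) (BijGroup T)"
proof (rule homI)
  fix g h assume gh: "g \<in> carrier (Sym N \<times>\<times> Sym X)" "h \<in> carrier (Sym N \<times>\<times> Sym X)"
  have "act_lr T (g \<otimes>\<^bsub>Sym N \<times>\<times> Sym X\<^esub> h) R = compose T (act_lr T g) (act_lr T h) R" for R
  proof (cases "R \<in> T")
    case True
    have "act_lr T h R \<in> T"
      using act_lr_Bij[OF gh(2)] True unfolding Bij_def by (auto simp: bij_betw_def)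
    then show ?thesis using True
      by (simp add: compose_eq act_lr_image DirProd_def Sym_def case_prod_unfold image_image map_prod_compose[symmetric])
        (simp add: map_prod_def case_prod_unfold)
  next
    case False
    then show ?thesis by (simp add: act_lr_def compose_def)
  qed
  then show "act_lr T (g \<otimes>\<^bsub>Sym N \<times>\<times> Sym X\<^esub> h) = act_lr T g \<otimes>\<^bsub>BijGroup T\<^esub> act_lr T h"
    using act_lr_Bij[OF gh(1)] act_lr_Bij[OF gh(2)] unfolding BijGroup_def by (simp add: fun_eq_iff)
qed (simp add: BijGroup_def act_lr_Bij)

text \<open>
  Stated for a group that acts through a homomorphism \<open>\<phi>\<close>, so that the two one-sided actions, where
  \<open>\<phi>\<close> embeds a factor, and the two-sided one, where it is the identity, are instances.
\<close>

lemma burnside_family: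
  assumes G: "group G" "finite (carrier G)" and \<phi>: "\<phi> \<in> hom G (Sym N \<times>\<times> Sym X)"
  shows "card (orbits G T (act_lr T \<circ> \<phi>)) * order G =
    (\<Sum>g\<in>carrier G. card (Fix_lr T (fst (\<phi> g)) (snd (\<phi> g))))"
proof -
  have "act_lr T \<circ> \<phi> \<in> hom G (BijGroup T)"
    using \<phi> act_lr_hom by (rule hom_compose)
  then have "group_action G T (act_lr T \<circ> \<phi>)"
    unfolding group_action_def group_hom_def group_hom_axioms_def using G(1) group_BijGroup by blast
  then show ?thesis
    using group_action.burnside[OF _ G(2) finite_family]
    by (simp add: Fix_lr_def invariants_def)
qed

lemma burnside_lr:
  "real (num_orbits_lr N X T) * (fact (card N) * fact (card X)) =
    (\<Sum>\<pi> | \<pi> permutes N. \<Sum>\<sigma> | \<sigma> permutes X. real (card (Fix_lr T \<pi> \<sigma>)))"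
proof -
  let ?G = "Sym N \<times>\<times> Sym X"
  have car: "carrier ?G = {\<pi>. \<pi> permutes N} \<times> {\<sigma>. \<sigma> permutes X}"
    by (simp add: DirProd_def Sym_def)
  have "card (orbits ?G T (act_lr T \<circ> id)) * order ?G =
      (\<Sum>g\<in>carrier ?G. card (Fix_lr T (fst (id g)) (snd (id g))))"
  proof (rule burnside_family)
    show "finite (carrier ?G)" unfolding car by (simp add: finite_permutations finN finX)
  qed (simp_all add: DirProd_group group_Sym hom_def Pi_def)
  moreover have "order ?G = fact (card N) * fact (card X)"
    unfolding order_def car by (simp add: card_cartesian_product card_permutations finN finX)
  ultimately have "num_orbits_lr N X T * (fact (card N) * fact (card X)) =
      (\<Sum>\<pi> | \<pi> permutes N. \<Sum>\<sigma> | \<sigma> permutes X. card (Fix_lr T \<pi> \<sigma>))"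
    unfolding num_orbits_lr_def car by (simp add: sum.cartesian_product case_prod_unfold)
  then have "real (num_orbits_lr N X T * (fact (card N) * fact (card X))) =
      real (\<Sum>\<pi> | \<pi> permutes N. \<Sum>\<sigma> | \<sigma> permutes X. card (Fix_lr T \<pi> \<sigma>))"
    by (rule arg_cong)
  then show ?thesis by simp
qed

lemma burnside_l:
  "real (num_orbits_l N T) * fact (card N) = (\<Sum>\<pi> | \<pi> permutes N. real (card (Fix_l T \<pi>)))"
proof -
  have "card (orbits (Sym N) T (act_lr T \<circ> (\<lambda>\<pi>. (\<pi>, id)))) * order (Sym N) =
      (\<Sum>\<pi>\<in>carrier (Sym N). card (Fix_lr T \<pi> id))"
    by (rule burnside_family[where \<phi> = "\<lambda>\<pi>. (\<pi>, id)", unfolded fst_conv snd_conv])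
      (rule group_Sym,
        simp_all add: finite_permutations finN hom_def Pi_def DirProd_def Sym_def permutes_id)
  moreover have "act_lr T \<circ> (\<lambda>\<pi>. (\<pi>, id)) = act_l T"
    unfolding act_l_def comp_def ..
  ultimately have "num_orbits_l N T * fact (card N) = (\<Sum>\<pi> | \<pi> permutes N. card (Fix_l T \<pi>))"
    unfolding num_orbits_l_def order_Sym[OF finN] by (simp add: Fix_l_altdef Sym_def)
  then have "real (num_orbits_l N T * fact (card N)) = real (\<Sum>\<pi> | \<pi> permutes N. card (Fix_l T \<pi>))"
    by (rule arg_cong)
  then show ?thesis by simp
qed

lemma burnside_r:
  "real (num_orbits_r X T) * fact (card X) = (\<Sum>\<sigma> | \<sigma> permutes X. real (card (Fix_r T \<sigma>)))"
proof -
  have "card (orbits (Sym X) T (act_lr T \<circ> (\<lambda>\<sigma>. (id, \<sigma>)))) * order (Sym X) =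
      (\<Sum>\<sigma>\<in>carrier (Sym X). card (Fix_lr T id \<sigma>))"
    by (rule burnside_family[where \<phi> = "\<lambda>\<sigma>. (id, \<sigma>)", unfolded fst_conv snd_conv])
      (rule group_Sym,
        simp_all add: finite_permutations finX hom_def Pi_def DirProd_def Sym_def permutes_id)
  moreover have "act_lr T \<circ> (\<lambda>\<sigma>. (id, \<sigma>)) = act_r T"
    unfolding act_r_def comp_def ..
  ultimately have "num_orbits_r X T * fact (card X) = (\<Sum>\<sigma> | \<sigma> permutes X. card (Fix_r T \<sigma>))"
    unfolding num_orbits_r_def order_Sym[OF finX] by (simp add: Fix_r_altdef Sym_def)
  then have "real (num_orbits_r X T * fact (card X)) = real (\<Sum>\<sigma> | \<sigma> permutes X. card (Fix_r T \<sigma>))"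
    by (rule arg_cong)
  then show ?thesis by simp
qed

lemma num_orbits_l_eq:
  assumes "\<And>\<pi>. \<pi> permutes N \<Longrightarrow> real (card (Fix_l T \<pi>)) = G (cycle_type N \<pi>)"
  shows "real (num_orbits_l N T) = (\<Sum>a\<in>cycle_types (card N). cycle_weight (card N) a * G a)"
proof -
  have "real (num_orbits_l N T) * fact (card N) = (\<Sum>\<pi> | \<pi> permutes N. G (cycle_type N \<pi>))"
    unfolding burnside_l by (rule sum.cong) (simp_all add: assms)
  then show ?thesis unfolding sum_over_permutations[OF finN refl] by simp
qed

lemma num_orbits_r_eq:
  assumes "\<And>\<sigma>. \<sigma> permutes X \<Longrightarrow> real (card (Fix_r T \<sigma>)) = G (cycle_type X \<sigma>)"
  shows "real (num_orbits_r X T) = (\<Sum>b\<in>cycle_types (card X). cycle_weight (card X) b * G b)"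
proof -
  have "real (num_orbits_r X T) * fact (card X) = (\<Sum>\<sigma> | \<sigma> permutes X. G (cycle_type X \<sigma>))"
    unfolding burnside_r by (rule sum.cong) (simp_all add: assms)
  then show ?thesis unfolding sum_over_permutations[OF finX refl] by simp
qed

lemma num_orbits_lr_eq:
  assumes "\<And>\<pi> \<sigma>. \<pi> permutes N \<Longrightarrow> \<sigma> permutes X \<Longrightarrow>
    real (card (Fix_lr T \<pi> \<sigma>)) = G (cycle_type N \<pi>) (cycle_type X \<sigma>)"
  shows "real (num_orbits_lr N X T) = (\<Sum>a\<in>cycle_types (card N). \<Sum>b\<in>cycle_types (card X).
    cycle_weight (card N) a * cycle_weight (card X) b * G a b)"
proof -
  have "real (num_orbits_lr N X T) * (fact (card N) * fact (card X)) =
      (\<Sum>\<pi> | \<pi> permutes N. \<Sum>\<sigma> | \<sigma> permutes X. G (cycle_type N \<pi>) (cycle_type X \<sigma>))"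
    unfolding burnside_lr by (intro sum.cong refl) (simp_all add: assms)
  also have "\<dots> = (\<Sum>\<pi> | \<pi> permutes N. fact (card X) *
      (\<Sum>b\<in>cycle_types (card X). cycle_weight (card X) b * G (cycle_type N \<pi>) b))"
    by (rule sum.cong[OF refl], rule sum_over_permutations[OF finX refl])
  also have "\<dots> = fact (card N) * (\<Sum>a\<in>cycle_types (card N). cycle_weight (card N) a *
      (fact (card X) * (\<Sum>b\<in>cycle_types (card X). cycle_weight (card X) b * G a b)))"
    by (rule sum_over_permutations[OF finN refl])
  also have "\<dots> = (\<Sum>a\<in>cycle_types (card N). \<Sum>b\<in>cycle_types (card X).
      cycle_weight (card N) a * cycle_weight (card X) b * G a b) * (fact (card N) * fact (card X))"
    unfolding sum_distrib_left sum_distrib_right by (intro sum.cong refl) simp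
  finally show ?thesis by simp
qed

text \<open>
  Conjugating permutations of \<open>N\<close> and \<open>X\<close> map the relations fixed by one pair injectively to those
  fixed by the other one. By symmetry the two numbers agree, so they depend on cycle types only.
\<close>

lemma card_Fix_lr_le_conjugate:
  assumes p: "\<pi> permutes N" "\<pi>' permutes N" "\<sigma> permutes X" "\<sigma>' permutes X"
    and eq: "cycle_type N \<pi> = cycle_type N \<pi>'" "cycle_type X \<sigma> = cycle_type X \<sigma>'"
  shows "card (Fix_lr T \<pi> \<sigma>) \<le> card (Fix_lr T \<pi>' \<sigma>')"
proof -
  obtain \<tau> where \<tau>: "\<tau> permutes N" "\<tau> \<circ> \<pi> = \<pi>' \<circ> \<tau>"
    using conjugate_if_same_cycle_type[OF finN p(1,2) eq(1)] .
  obtain \<rho> where \<rho>: "\<rho> permutes X" "\<rho> \<circ> \<sigma> = \<sigma>' \<circ> \<rho>"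
    using conjugate_if_same_cycle_type[OF finX p(3,4) eq(2)] .
  show ?thesis
  proof (rule card_inj_on_le)
    have "inj (map_prod \<tau> \<rho>)" using permutes_inj[OF \<tau>(1)] permutes_inj[OF \<rho>(1)] by (rule prod.inj_map)
    then show "inj_on ((`) (map_prod \<tau> \<rho>)) (Fix_lr T \<pi> \<sigma>)"
      by (intro inj_onI) (simp add: inj_image_eq_iff)
    have "map_prod \<pi>' \<sigma>' ` map_prod \<tau> \<rho> ` R = map_prod \<tau> \<rho> ` R" if "map_prod \<pi> \<sigma> ` R = R" for R
    proof -
      have "map_prod \<pi>' \<sigma>' ` map_prod \<tau> \<rho> ` R = map_prod (\<pi>' \<circ> \<tau>) (\<sigma>' \<circ> \<rho>) ` R"
        by (simp only: image_comp map_prod_compose)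
      also have "\<dots> = map_prod \<tau> \<rho> ` map_prod \<pi> \<sigma> ` R"
        by (simp only: \<tau>(2)[symmetric] \<rho>(2)[symmetric] image_comp map_prod_compose)
      finally show ?thesis using that by simp
    qed
    then show "(`) (map_prod \<tau> \<rho>) ` Fix_lr T \<pi> \<sigma> \<subseteq> Fix_lr T \<pi>' \<sigma>'"
      unfolding Fix_lr_altdef image_subset_iff using closed[OF \<tau>(1) \<rho>(1)] by simp
  qed (rule finite_Fix_lr)
qed

lemma card_Fix_lr_class_function:
  "\<exists>F. \<forall>\<pi> \<sigma>. \<pi> permutes N \<and> \<sigma> permutes X \<longrightarrow> card (Fix_lr T \<pi> \<sigma>) = F (cycle_type N \<pi>) (cycle_type X \<sigma>)"
proof -
  define rN where "rN = (\<lambda>a. SOME \<pi>. \<pi> permutes N \<and> cycle_type N \<pi> = a)"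
  define rX where "rX = (\<lambda>b. SOME \<sigma>. \<sigma> permutes X \<and> cycle_type X \<sigma> = b)"
  have "card (Fix_lr T \<pi> \<sigma>) = card (Fix_lr T (rN (cycle_type N \<pi>)) (rX (cycle_type X \<sigma>)))"
    if p: "\<pi> permutes N" "\<sigma> permutes X" for \<pi> \<sigma>
  proof -
    have N: "rN (cycle_type N \<pi>) permutes N \<and> cycle_type N (rN (cycle_type N \<pi>)) = cycle_type N \<pi>"
      unfolding rN_def by (rule someI[of _ \<pi>]) (use p in simp)
    have X: "rX (cycle_type X \<sigma>) permutes X \<and> cycle_type X (rX (cycle_type X \<sigma>)) = cycle_type X \<sigma>"
      unfolding rX_def by (rule someI[of _ \<sigma>]) (use p in simp)
    show ?thesis
      by (intro antisym card_Fix_lr_le_conjugate) (simp_all add: p N X)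
  qed
  then show ?thesis by (intro exI[of _ "\<lambda>a b. card (Fix_lr T (rN a) (rX b))"]) blast
qed

end

section \<open>Fixed relations\<close>

lemma rel_Ir_altdef: "rel_Ir N X = {R. R \<subseteq> N \<times> X \<and> single_valued (R\<inverse>)}"
  unfolding rel_Ir_def relations_def right_injective_def Uniq_def single_valued_def by blast

lemma rel_Sr_altdef: "rel_Sr N X = {R. R \<subseteq> N \<times> X \<and> Range R = X}"
  unfolding rel_Sr_def relations_def right_surjective_def by blast

lemma rel_Ilr_altdef: "rel_Ilr N X = {R. R \<subseteq> N \<times> X \<and> single_valued R \<and> single_valued (R\<inverse>)}"
  unfolding rel_Ilr_def relations_def right_injective_def left_injective_def Uniq_def single_valued_def by blast

lemma rel_Slr_altdef: "rel_Slr N X = {R. R \<subseteq> N \<times> X \<and> Domain R = N \<and> Range R = X}"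
  unfolding rel_Slr_def relations_def right_surjective_def left_surjective_def by blast

lemma symmetric_families:
  assumes fin: "finite N" "finite X"
    and T: "T \<in> {relations N X, rel_Ir N X, rel_Sr N X, rel_Ilr N X, rel_Slr N X}"
  shows "symmetric_family N X T"
proof
  show "T \<subseteq> relations N X"
    using T unfolding rel_Ir_def rel_Sr_def rel_Ilr_def rel_Slr_def by blast
  fix \<pi> \<sigma> R assume p: "\<pi> permutes N" "\<sigma> permutes X" and R: "R \<in> T"
  let ?g = "map_prod \<pi> \<sigma>"
  have rel: "?g ` R \<subseteq> N \<times> X" if "R \<subseteq> N \<times> X"
  proof (rule image_subsetI)
    fix z assume "z \<in> R"
    then have "z \<in> N \<times> X" using that by blast
    then show "?g z \<in> N \<times> X"
      by (cases z) (simp add: permutes_in_image[OF p(1)] permutes_in_image[OF p(2)])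
  qed
  have Dom: "Domain (?g ` R) = \<pi> ` Domain R" and Ran: "Range (?g ` R) = \<sigma> ` Range R"
    by (simp_all add: Domain_fst Range_snd image_comp)
  have inj: "\<pi> i = \<pi> j \<longleftrightarrow> i = j" "\<sigma> c = \<sigma> d \<longleftrightarrow> c = d" for i j c d
    using p[THEN permutes_inj] by (simp_all add: inj_eq)
  have sv: "single_valued (?g ` R)" if "single_valued R"
    using that unfolding single_valued_def by (auto simp: inj)
  have sv': "single_valued ((?g ` R)\<inverse>)" if "single_valued (R\<inverse>)"
    using that unfolding single_valued_def by (auto simp: inj)
  show "?g ` R \<in> T"
    using T R rel sv sv' permutes_image[OF p(1)] permutes_image[OF p(2)]
    unfolding rel_Ir_altdef rel_Sr_altdef rel_Ilr_altdef rel_Slr_altdef relations_def insert_iff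
    by (elim disjE) (simp_all add: Dom Ran)
qed (use fin in simp_all)

text \<open>
  An equivariant map \<open>f\<close> is determined by its values on representatives of the cycles. The
  representative of a cycle \<open>C\<close> is fixed by \<open>p ^^ card C\<close>, so its value is fixed by \<open>\<phi> ^^ card C\<close>.
  Conversely, such a value can be propagated along the cycle: the element \<open>s\<close> is reached from the
  representative after \<open>idx s\<close> steps, and a different number of steps is congruent to it modulo
  the length of the cycle.
\<close>

lemma (in finite_perm) card_equivariant_maps:
  assumes E: "\<phi> \<in> E \<rightarrow> E"
  shows "card {f \<in> S \<rightarrow>\<^sub>E E. \<forall>s\<in>S. f (p s) = \<phi> (f s)} =
    (\<Prod>C\<in>cycles S p. card {e \<in> E. (\<phi> ^^ card C) e = e})"
proof -
  define rep where "rep C = (SOME s. s \<in> C)" for C :: "'a set"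
  define idx where "idx s = (SOME m. (p ^^ m) (rep (cyc s)) = s)" for s
  let ?H = "{f \<in> S \<rightarrow>\<^sub>E E. \<forall>s\<in>S. f (p s) = \<phi> (f s)}"
  let ?P = "\<Pi>\<^sub>E C\<in>cycles S p. {e \<in> E. (\<phi> ^^ card C) e = e}"
  have rep: "rep C \<in> C" if "C \<in> cycles S p" for C
    using cycles_nonempty[OF that] unfolding rep_def by (simp add: some_in_eq)
  have repS: "rep C \<in> S" "cyc (rep C) = C" if "C \<in> cycles S p" for C
    using cycle_in_cycles[OF that rep[OF that]] by simp_all
  have cycS: "cyc s \<in> cycles S p" if "s \<in> S" for s using that unfolding cycles_def by blast
  have idx: "(p ^^ idx s) (rep (cyc s)) = s" if s: "s \<in> S" for s
  proof -
    have "s \<in> cyc (rep (cyc s))" unfolding repS(2)[OF cycS[OF s]] by (rule self_in_cycle[OF s])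
    then show ?thesis
      unfolding cycle_funpow[OF repS(1)[OF cycS[OF s]]] idx_def by (metis (mono_tags, lifting) imageE someI)
  qed
  have equiv: "f ((p ^^ m) s) = (\<phi> ^^ m) (f s)" if f: "f \<in> ?H" and s: "s \<in> S" for f s m
    by (induction m) (use f funpow_in[OF s] in simp_all)
  have E_funpow: "(\<phi> ^^ m) e \<in> E" if "e \<in> E" for e m
    by (induction m) (use E that in auto)
  have "bij_betw (\<lambda>f. \<lambda>C\<in>cycles S p. f (rep C)) ?H ?P"
  proof (rule bij_betwI[where g = "\<lambda>g. \<lambda>s\<in>S. (\<phi> ^^ idx s) (g (cyc s))"])
    show "(\<lambda>f. \<lambda>C\<in>cycles S p. f (rep C)) \<in> ?H \<rightarrow> ?P"
    proof (rule funcsetI, rule PiE_I)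
      fix f C assume f: "f \<in> ?H" and C: "C \<in> cycles S p"
      have "(\<phi> ^^ card C) (f (rep C)) = f ((p ^^ card C) (rep C))"
        using equiv[OF f repS(1)[OF C]] by simp
      also have "\<dots> = f (rep C)" using funpow_card_cycle[OF repS(1)[OF C]] repS(2)[OF C] by simp
      finally show "(\<lambda>C\<in>cycles S p. f (rep C)) C \<in> {e \<in> E. (\<phi> ^^ card C) e = e}"
        using f C repS(1)[OF C] by auto
    qed simp
    show "(\<lambda>g. \<lambda>s\<in>S. (\<phi> ^^ idx s) (g (cyc s))) \<in> ?P \<rightarrow> ?H"
    proof (rule funcsetI)
      fix g assume g: "g \<in> ?P"
      have gE: "g (cyc s) \<in> E" "(\<phi> ^^ card (cyc s)) (g (cyc s)) = g (cyc s)" if "s \<in> S" for s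
        using PiE_mem[OF g cycS[OF that]] by simp_all
      have "(\<phi> ^^ idx (p s)) (g (cyc (p s))) = \<phi> ((\<phi> ^^ idx s) (g (cyc s)))" if s: "s \<in> S" for s
      proof -
        have ps: "p s \<in> S" using funpow_in[OF s, of 1] by simp
        have cp: "cyc (p s) = cyc s" by (rule cycle_eq[OF s orbit.base])
        have "(p ^^ idx (p s)) (rep (cyc s)) = (p ^^ Suc (idx s)) (rep (cyc s))"
          using idx[OF s] idx[OF ps] by (simp add: cp)
        then have "idx (p s) mod card (cyc s) = Suc (idx s) mod card (cyc s)"
          using funpow_eq_imp_mod_eq[OF repS(1)[OF cycS[OF s]]] repS(2)[OF cycS[OF s]] by metis
        then have "(\<phi> ^^ idx (p s)) (g (cyc s)) = (\<phi> ^^ Suc (idx s)) (g (cyc s))"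
          using funpow_mod_eq[OF gE(2)[OF s]] by metis
        then show ?thesis by (simp add: cp)
      qed
      moreover have "p s \<in> S" if "s \<in> S" for s using funpow_in[OF that, of 1] by simp
      ultimately show "(\<lambda>s\<in>S. (\<phi> ^^ idx s) (g (cyc s))) \<in> ?H"
        using gE(1) E_funpow by simp
    qed
    show "(\<lambda>s\<in>S. (\<phi> ^^ idx s) ((\<lambda>C\<in>cycles S p. f (rep C)) (cyc s))) = f" if f: "f \<in> ?H" for f
    proof
      fix s show "(\<lambda>s\<in>S. (\<phi> ^^ idx s) ((\<lambda>C\<in>cycles S p. f (rep C)) (cyc s))) s = f s"
      proof (cases "s \<in> S")
        case True
        have "(\<phi> ^^ idx s) (f (rep (cyc s))) = f s"
          using equiv[OF f repS(1)[OF cycS[OF True]], of "idx s"] idx[OF True] by simp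
        then show ?thesis using True cycS by simp
      next
        case False
        then show ?thesis using f by (auto simp: PiE_def extensional_def)
      qed
    qed
    show "(\<lambda>C\<in>cycles S p. (\<lambda>s\<in>S. (\<phi> ^^ idx s) (g (cyc s))) (rep C)) = g" if g: "g \<in> ?P" for g
    proof
      fix C show "(\<lambda>C\<in>cycles S p. (\<lambda>s\<in>S. (\<phi> ^^ idx s) (g (cyc s))) (rep C)) C = g C"
      proof (cases "C \<in> cycles S p")
        case True
        have gC: "(\<phi> ^^ card C) (g C) = g C" using PiE_mem[OF g True] by simp
        have "(p ^^ idx (rep C)) (rep C) = rep C"
          using idx[OF repS(1)[OF True]] repS(2)[OF True] by simp
        then have "card C dvd idx (rep C)"
          using funpow_fixed_iff[OF repS(1)[OF True]] repS(2)[OF True] by simp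
        then have "(\<phi> ^^ idx (rep C)) (g C) = g C"
          using funpow_mod_eq[OF gC, of "idx (rep C)"] by simp
        then show ?thesis using True repS[OF True] by simp
      next
        case False
        then show ?thesis using PiE_arb[OF g False] by simp
      qed
    qed
  qed
  then have "card ?H = card ?P" by (rule bij_betw_same_card)
  also have "\<dots> = (\<Prod>C\<in>cycles S p. card {e \<in> E. (\<phi> ^^ card C) e = e})"
    by (rule card_PiE[OF cycles_finite])
  finally show ?thesis .
qed

lemma funpow_image:
  fixes f :: "'a \<Rightarrow> 'a"
  shows "((`) f ^^ m) A = (f ^^ m) ` A"
  by (induction m) (simp_all add: image_comp)

text \<open>
  Fixed relations are equivariant maps that assign to each element of \<open>X\<close> its column. The
  conditions of right injectivity and right surjectivity concern each column separately.
\<close>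

lemma (in two_perms) card_fixed_by_columns:
  assumes \<A>: "\<A> \<subseteq> Pow N" and closed: "\<And>A. A \<in> \<A> \<Longrightarrow> \<pi> ` A \<in> \<A>"
  shows "card {R. R \<subseteq> N \<times> X \<and> map_prod \<pi> \<sigma> ` R = R \<and> (\<forall>c\<in>X. {i. (i, c) \<in> R} \<in> \<A>)} =
    (\<Prod>C\<in>cycles X \<sigma>. card {A \<in> \<A>. (\<pi> ^^ card C) ` A = A})"
proof -
  let ?F = "{R. R \<subseteq> N \<times> X \<and> map_prod \<pi> \<sigma> ` R = R \<and> (\<forall>c\<in>X. {i. (i, c) \<in> R} \<in> \<A>)}"
  let ?H = "{f \<in> X \<rightarrow>\<^sub>E \<A>. \<forall>c\<in>X. f (\<sigma> c) = \<pi> ` f c}"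
  have \<sigma>X: "\<sigma> c \<in> X" if "c \<in> X" for c using bij_betwE[OF X.bij] that by blast
  have "bij_betw (\<lambda>R. \<lambda>c\<in>X. {i. (i, c) \<in> R}) ?F ?H"
  proof (rule bij_betwI[where g = "\<lambda>f. {(i, c). c \<in> X \<and> i \<in> f c}"])
    show "(\<lambda>R. \<lambda>c\<in>X. {i. (i, c) \<in> R}) \<in> ?F \<rightarrow> ?H"
    proof (rule funcsetI)
      fix R assume "R \<in> ?F"
      then have R: "R \<subseteq> N \<times> X" "map_prod \<pi> \<sigma> ` R = R" "\<forall>c\<in>X. {i. (i, c) \<in> R} \<in> \<A>" by blast+
      have "{i. (i, \<sigma> c) \<in> R} = \<pi> ` {i. (i, c) \<in> R}" if c: "c \<in> X" for c
      proof (intro equalityI subsetI)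
        fix i assume "i \<in> {i. (i, \<sigma> c) \<in> R}"
        then have "(i, \<sigma> c) \<in> map_prod \<pi> \<sigma> ` R" unfolding R(2) by simp
        then obtain j d where jd: "(j, d) \<in> R" "i = \<pi> j" "\<sigma> c = \<sigma> d" by auto
        have "d \<in> X" using jd(1) R(1) by blast
        then have "c = d" using jd(3) c bij_betw_imp_inj_on[OF X.bij] unfolding inj_on_def by blast
        then show "i \<in> \<pi> ` {i. (i, c) \<in> R}" using jd(1,2) by blast
      next
        fix i assume "i \<in> \<pi> ` {i. (i, c) \<in> R}"
        then obtain j where j: "(j, c) \<in> R" "i = \<pi> j" by blast
        then have "map_prod \<pi> \<sigma> (j, c) \<in> map_prod \<pi> \<sigma> ` R" by blast
        then have "map_prod \<pi> \<sigma> (j, c) \<in> R" unfolding R(2) .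
        then show "i \<in> {i. (i, \<sigma> c) \<in> R}" using j(2) by simp
      qed
      then show "(\<lambda>c\<in>X. {i. (i, c) \<in> R}) \<in> ?H" using R(3) \<sigma>X by simp
    qed
    show "(\<lambda>f. {(i, c). c \<in> X \<and> i \<in> f c}) \<in> ?H \<rightarrow> ?F"
    proof (rule funcsetI)
      fix f assume "f \<in> ?H"
      then have fA: "f c \<in> \<A>" and feq: "f (\<sigma> c) = \<pi> ` f c" if "c \<in> X" for c
        using that by (blast dest: PiE_mem)+
      let ?R = "{(i, c). c \<in> X \<and> i \<in> f c}"
      have sub: "?R \<subseteq> N \<times> X" using fA \<A> by blast
      moreover have "\<forall>z\<in>?R. map_prod \<pi> \<sigma> z \<in> ?R"
      proof
        fix z assume "z \<in> ?R"
        then obtain i c where z: "z = (i, c)" "c \<in> X" "i \<in> f c" by blast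
        then have "\<pi> i \<in> f (\<sigma> c)" unfolding feq[OF z(2)] by blast
        then show "map_prod \<pi> \<sigma> z \<in> ?R" using \<sigma>X[OF z(2)] z(1) by simp
      qed
      then have "map_prod \<pi> \<sigma> ` ?R = ?R" using NX.image_eq_iff_closed[OF sub] by blast
      moreover have "\<forall>c\<in>X. {i. (i, c) \<in> ?R} \<in> \<A>" using fA by simp
      ultimately show "?R \<in> ?F" by blast
    qed
    show "{(i, c). c \<in> X \<and> i \<in> (\<lambda>c\<in>X. {i. (i, c) \<in> R}) c} = R" if "R \<in> ?F" for R
    proof -
      have "R \<subseteq> N \<times> X" using that by blast
      then show ?thesis by auto
    qed
    show "(\<lambda>c\<in>X. {i. (i, c) \<in> {(i, c). c \<in> X \<and> i \<in> f c}}) = f" if f: "f \<in> ?H" for f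
    proof
      fix c show "(\<lambda>c\<in>X. {i. (i, c) \<in> {(i, c). c \<in> X \<and> i \<in> f c}}) c = f c"
        using f by (cases "c \<in> X") (simp_all add: PiE_def extensional_def)
    qed
  qed
  then have "card ?F = card ?H" by (rule bij_betw_same_card)
  also have "\<dots> = (\<Prod>C\<in>cycles X \<sigma>. card {A \<in> \<A>. ((`) \<pi> ^^ card C) A = A})"
    by (rule X.card_equivariant_maps) (use closed in blast)
  finally show ?thesis by (simp only: funpow_image)
qed

context finite_perm
begin

lemma finite_perm_funpow: "finite_perm S (p ^^ m)"
  by unfold_locales (rule fin, rule bij_betw_funpow[OF bij])

lemma card_fixed_points_funpow:
  assumes k: "k > 0"
  shows "card {s \<in> S. (p ^^ k) s = s} = (\<Sum>d | d dvd k. d * cycle_type S p d)"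
proof -
  have "{s \<in> S. (p ^^ k) s = s} = (\<Union>d\<in>{d. d dvd k}. {s \<in> S. card (cyc s) = d})"
    using funpow_fixed_iff by blast
  also have "card \<dots> = (\<Sum>d | d dvd k. card {s \<in> S. card (cyc s) = d})"
    by (rule card_UN_disjoint) (use k fin in \<open>auto simp: finite_divisors_nat\<close>)
  finally show ?thesis unfolding card_elements_on_cycles_of_length .
qed

end

text \<open>
  A product over cycle lengths for the identity permutation, whose \<open>m\<close> cycles all have length 1.
\<close>

lemma prod_at_one:
  "(\<Prod>k=1..m. g k ^ (if k = 1 then m else 0)) = (g 1 ^ m :: 'a::comm_monoid_mult)"
proof (cases "m = 0")
  case False
  have "(\<Prod>k=1..m. g k ^ (if k = 1 then m else 0)) = (\<Prod>k=1..m. if k = 1 then g 1 ^ m else 1)"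
    by (rule prod.cong) auto
  then show ?thesis using False by (simp add: prod.delta)
qed simp

lemma sum_over_Pow_card:
  assumes "finite U"
  shows "(\<Sum>K\<in>Pow U. h (card K)) = (\<Sum>k=0..card U. of_nat (card U choose k) * (h k :: 'a::comm_semiring_1))"
proof -
  have "(\<Sum>K\<in>Pow U. h (card K)) = (\<Sum>k=0..card U. \<Sum>K\<in>{K \<in> Pow U. card K = k}. h (card K))"
    by (rule sum.group[symmetric]) (use assms card_mono in auto)
  also have "\<dots> = (\<Sum>k=0..card U. of_nat (card U choose k) * h k)"
    by (rule sum.cong[OF refl]) (simp add: n_subsets[OF assms])
  finally show ?thesis .
qed

lemma alternating_sum_Pow:
  assumes "finite U"
  shows "(\<Sum>K\<in>Pow U. (- 1) ^ card K) = (if U = {} then 1 else 0 :: real)"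
proof (cases "U = {}")
  case False
  then have "card U > 0" using assms by (simp add: card_gt_0_iff)
  then have "(\<Sum>k\<le>card U. (- 1) ^ k * real (card U choose k)) = 0"
    by (rule choose_alternating_sum)
  then show ?thesis
    unfolding sum_over_Pow_card[OF assms] using False by (simp add: atMost_atLeast0 mult.commute)
qed simp

context two_perms
begin

lemma card_Fix_lr_relations:
  "card (Fix_lr (relations N X) \<pi> \<sigma>) =
    2 ^ (\<Sum>i=1..card N. \<Sum>j=1..card X. cycle_type N \<pi> i * cycle_type X \<sigma> j * gcd i j)"
  using NX.card_fixed_subsets unfolding card_cycles_product Fix_lr_altdef relations_def by simp

text \<open>
  The admissible columns are the empty set and the singletons, and the latter are fixed by
  \<open>\<pi> ^^ k\<close> exactly if the element lies on a cycle whose length divides \<open>k\<close>.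
\<close>

lemma card_Fix_lr_Ir:
  "card (Fix_lr (rel_Ir N X) \<pi> \<sigma>) =
    (\<Prod>k=1..card X. (1 + (\<Sum>d | d dvd k. d * cycle_type N \<pi> d)) ^ cycle_type X \<sigma> k)"
proof -
  let ?\<A> = "insert {} ((\<lambda>i. {i}) ` N)"
  have \<pi>N: "\<pi> i \<in> N" if "i \<in> N" for i using bij_betwE[OF N.bij] that by blast
  have iff: "single_valued (R\<inverse>) \<longleftrightarrow> (\<forall>c\<in>X. {i. (i, c) \<in> R} \<in> ?\<A>)" if R: "R \<subseteq> N \<times> X" for R
  proof
    assume sv: "single_valued (R\<inverse>)"
    show "\<forall>c\<in>X. {i. (i, c) \<in> R} \<in> ?\<A>"
    proof
      fix c
      show "{i. (i, c) \<in> R} \<in> ?\<A>"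
      proof (cases "\<exists>i. (i, c) \<in> R")
        case True
        then obtain i where i: "(i, c) \<in> R" by blast
        then have "{i. (i, c) \<in> R} = {i}" using sv unfolding single_valued_def by blast
        then show ?thesis using i R by blast
      qed simp
    qed
  next
    assume *: "\<forall>c\<in>X. {i. (i, c) \<in> R} \<in> ?\<A>"
    show "single_valued (R\<inverse>)"
      unfolding single_valued_def converse_iff
    proof (intro allI impI)
      fix c i j assume ij: "(i, c) \<in> R" "(j, c) \<in> R"
      then have "{i. (i, c) \<in> R} \<in> ?\<A>" using * R by blast
      then obtain l where l: "{i. (i, c) \<in> R} = {l}" using ij by blast
      have "i \<in> {i. (i, c) \<in> R}" "j \<in> {i. (i, c) \<in> R}" using ij by simp_all
      then show "i = j" unfolding l by simp
    qed
  qed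
  have "Fix_lr (rel_Ir N X) \<pi> \<sigma> =
      {R. R \<subseteq> N \<times> X \<and> map_prod \<pi> \<sigma> ` R = R \<and> (\<forall>c\<in>X. {i. (i, c) \<in> R} \<in> ?\<A>)}"
    unfolding Fix_lr_altdef rel_Ir_altdef mem_Collect_eq using iff by (intro Collect_cong) meson
  also have "card \<dots> = (\<Prod>C\<in>cycles X \<sigma>. card {A \<in> ?\<A>. (\<pi> ^^ card C) ` A = A})"
    by (rule card_fixed_by_columns) (use \<pi>N in auto)
  also have "\<dots> = (\<Prod>C\<in>cycles X \<sigma>. 1 + (\<Sum>d | d dvd card C. d * cycle_type N \<pi> d))"
  proof (rule prod.cong[OF refl])
    fix C assume "C \<in> cycles X \<sigma>"
    then have k: "card C > 0" using X.card_cycle_in_range by fastforce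
    have "{A \<in> ?\<A>. (\<pi> ^^ card C) ` A = A} = insert {} ((\<lambda>i. {i}) ` {i \<in> N. (\<pi> ^^ card C) i = i})"
      by auto
    also have "card \<dots> = 1 + card {i \<in> N. (\<pi> ^^ card C) i = i}"
      using N.fin by (subst card_insert_disjoint) (auto simp: card_image)
    finally show "card {A \<in> ?\<A>. (\<pi> ^^ card C) ` A = A} = 1 + (\<Sum>d | d dvd card C. d * cycle_type N \<pi> d)"
      unfolding N.card_fixed_points_funpow[OF k] .
  qed
  also have "\<dots> = (\<Prod>k=1..card X. (1 + (\<Sum>d | d dvd k. d * cycle_type N \<pi> d)) ^ cycle_type X \<sigma> k)"
    by (rule X.prod_over_cycles)
  finally show ?thesis .
qed

lemma card_Fix_lr_Sr:
  "card (Fix_lr (rel_Sr N X) \<pi> \<sigma>) = (\<Prod>C\<in>cycles X \<sigma>. 2 ^ card (cycles N (\<pi> ^^ card C)) - 1)"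
proof -
  let ?\<A> = "Pow N - {{}}"
  have "Fix_lr (rel_Sr N X) \<pi> \<sigma> =
      {R. R \<subseteq> N \<times> X \<and> map_prod \<pi> \<sigma> ` R = R \<and> (\<forall>c\<in>X. {i. (i, c) \<in> R} \<in> ?\<A>)}"
  proof -
    have iff: "Range R = X \<longleftrightarrow> (\<forall>c\<in>X. {i. (i, c) \<in> R} \<in> ?\<A>)" if "R \<subseteq> N \<times> X" for R
      using that by blast
    show ?thesis
      unfolding Fix_lr_altdef rel_Sr_altdef mem_Collect_eq by (rule Collect_cong) (use iff in metis)
  qed
  also have "card \<dots> = (\<Prod>C\<in>cycles X \<sigma>. card {A \<in> ?\<A>. (\<pi> ^^ card C) ` A = A})"
    by (rule card_fixed_by_columns) (use bij_betwE[OF N.bij] in auto)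
  also have "\<dots> = (\<Prod>C\<in>cycles X \<sigma>. 2 ^ card (cycles N (\<pi> ^^ card C)) - 1)"
  proof (rule prod.cong[OF refl])
    fix C
    interpret Nk: finite_perm N "\<pi> ^^ card C" by (rule N.finite_perm_funpow)
    have "{A \<in> ?\<A>. (\<pi> ^^ card C) ` A = A} = {A. A \<subseteq> N \<and> (\<pi> ^^ card C) ` A = A} - {{}}" by blast
    then show "card {A \<in> ?\<A>. (\<pi> ^^ card C) ` A = A} = 2 ^ card (cycles N (\<pi> ^^ card C)) - 1"
      by (simp add: card_Diff_singleton Nk.card_fixed_subsets)
  qed
  finally show ?thesis .
qed

lemma Fix_lr_Ilr_eq_matchings: "Fix_lr (rel_Ilr N X) \<pi> \<sigma> = matchings False N \<pi> X \<sigma>"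
  unfolding Fix_lr_altdef rel_Ilr_altdef matchings_def by (intro equalityI subsetI CollectI) simp_all

lemma card_Fix_lr_Ilr:
  assumes "card N \<le> m" "card X \<le> m"
  shows "card (Fix_lr (rel_Ilr N X) \<pi> \<sigma>) =
    (\<Prod>k=1..m. match_count False k (cycle_type N \<pi> k) (cycle_type X \<sigma> k))"
  unfolding Fix_lr_Ilr_eq_matchings by (rule card_matchings[OF N.finite_perm_axioms X.finite_perm_axioms assms])

text \<open>
  Among the fixed right surjective relations, the two-sided surjective ones are those that miss no
  cycle of \<open>\<pi>\<close>, because the domain of a fixed relation is a union of cycles. Those that miss at least
  the cycles in \<open>K\<close> are the right surjective relations between the smaller set \<open>N - \<Union>K\<close> and \<open>X\<close>.
\<close>

lemma card_Fix_lr_Slr: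
  "real (card (Fix_lr (rel_Slr N X) \<pi> \<sigma>)) =
    (\<Sum>K\<in>Pow (cycles N \<pi>). (- 1) ^ card K * real (card (Fix_lr (rel_Sr (N - \<Union>K) X) \<pi> \<sigma>)))"
proof -
  let ?F = "Fix_lr (rel_Sr N X) \<pi> \<sigma>"
  let ?U = "\<lambda>R :: ('a \<times> 'b) set. {C \<in> cycles N \<pi>. C \<inter> Domain R = {}}"
  have finF: "finite ?F"
    by (rule finite_subset[of _ "Pow (N \<times> X)"]) (use NX.fin in \<open>auto simp: Fix_lr_altdef rel_Sr_altdef\<close>)
  have finU: "finite (?U R)" for R using N.cycles_finite by simp
  have sub: "Fix_lr (rel_Sr (N - \<Union>K) X) \<pi> \<sigma> = {R \<in> ?F. K \<subseteq> ?U R}" if K: "K \<in> Pow (cycles N \<pi>)" for K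
  proof -
    have iff: "R \<subseteq> (N - \<Union>K) \<times> X \<longleftrightarrow> R \<subseteq> N \<times> X \<and> K \<subseteq> ?U R" for R
      using K by blast
    show ?thesis unfolding Fix_lr_altdef rel_Sr_altdef mem_Collect_eq iff by (rule Collect_cong) argo
  qed
  have "(\<Sum>K\<in>Pow (cycles N \<pi>). (- 1) ^ card K * real (card (Fix_lr (rel_Sr (N - \<Union>K) X) \<pi> \<sigma>))) =
      (\<Sum>K\<in>Pow (cycles N \<pi>). \<Sum>R | R \<in> ?F \<and> K \<subseteq> ?U R. (- 1) ^ card K)"
    by (rule sum.cong[OF refl]) (simp add: sub)
  also have "\<dots> = (\<Sum>R\<in>?F. \<Sum>K | K \<in> Pow (cycles N \<pi>) \<and> K \<subseteq> ?U R. (- 1) ^ card K)"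
    by (rule sum.swap_restrict) (use finF N.cycles_finite in simp_all)
  also have "\<dots> = (\<Sum>R\<in>?F. \<Sum>K\<in>Pow (?U R). (- 1) ^ card K)"
    by (intro sum.cong refl) blast
  also have "\<dots> = (\<Sum>R\<in>?F. if ?U R = {} then 1 else 0)"
    by (intro sum.cong refl alternating_sum_Pow finU)
  also have "\<dots> = real (card {R \<in> ?F. ?U R = {}})"
    using finF by (simp add: sum.inter_filter[symmetric])
  also have "{R \<in> ?F. ?U R = {}} = Fix_lr (rel_Slr N X) \<pi> \<sigma>"
  proof -
    have iff: "?U R = {} \<longleftrightarrow> Domain R = N" if R: "R \<subseteq> N \<times> X" "map_prod \<pi> \<sigma> ` R = R" for R
    proof
      assume *: "?U R = {}"
      have "i \<in> Domain R" if i: "i \<in> N" for i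
      proof -
        have "N.cyc i \<inter> Domain R \<noteq> {}" using * i unfolding cycles_def by blast
        then obtain j c where j: "j \<in> N.cyc i" "(j, c) \<in> R" by blast
        have "j \<in> N" using j(2) R(1) by blast
        moreover have "i \<in> N.cyc j" using N.cycle_eq[OF i j(1)] N.self_in_cycle[OF i] by blast
        ultimately obtain m where m: "i = (\<pi> ^^ m) j" using N.cycle_funpow by blast
        have "((\<pi> ^^ m) j, (\<sigma> ^^ m) c) \<in> R" for m
        proof (induction m)
          case (Suc m)
          then have "map_prod \<pi> \<sigma> ((\<pi> ^^ m) j, (\<sigma> ^^ m) c) \<in> map_prod \<pi> \<sigma> ` R" by (rule imageI)
          then show ?case unfolding R(2) by simp
        qed (use j in simp)
        then show ?thesis using m by blast
      qed
      then show "Domain R = N" using R(1) by blast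
    next
      assume *: "Domain R = N"
      have "C \<inter> N \<noteq> {}" if "C \<in> cycles N \<pi>" for C
        using N.cycles_nonempty[OF that] N.Union_cycles that by blast
      then show "?U R = {}" unfolding * by blast
    qed
    have "((R \<subseteq> N \<times> X \<and> Range R = X) \<and> map_prod \<pi> \<sigma> ` R = R) \<and> ?U R = {} \<longleftrightarrow>
        (R \<subseteq> N \<times> X \<and> Domain R = N \<and> Range R = X) \<and> map_prod \<pi> \<sigma> ` R = R" for R
    proof (cases "R \<subseteq> N \<times> X \<and> map_prod \<pi> \<sigma> ` R = R")
      case True
      then have "?U R = {} \<longleftrightarrow> Domain R = N" by (elim conjE) (rule iff)
      then show ?thesis by argo
    qed argo
    then show ?thesis
      unfolding Fix_lr_altdef rel_Sr_altdef rel_Slr_altdef mem_Collect_eq by (rule Collect_cong)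
  qed
  finally show ?thesis ..
qed

end

lemma card_Fix_lr_Sr_id_right:
  assumes "finite_perm N \<pi>" "finite X"
  shows "card (Fix_lr (rel_Sr N X) \<pi> id) = (2 ^ card (cycles N \<pi>) - 1) ^ card X"
proof -
  have "two_perms N \<pi> X id" using assms by (intro two_perms.intro finite_perm_id)
  then have "card (Fix_lr (rel_Sr N X) \<pi> id) = (\<Prod>C\<in>cycles X id. 2 ^ card (cycles N (\<pi> ^^ card C)) - 1)"
    by (rule two_perms.card_Fix_lr_Sr)
  also have "\<dots> = (\<Prod>C\<in>cycles X id. 2 ^ card (cycles N \<pi>) - 1)"
    by (rule prod.cong[OF refl]) (auto simp: cycles_id)
  finally show ?thesis by (simp add: card_cycles_id)
qed

lemma card_Fix_lr_Sr_id_left: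
  assumes "finite N" "finite_perm X \<sigma>"
  shows "card (Fix_lr (rel_Sr N X) id \<sigma>) = (2 ^ card N - 1) ^ card (cycles X \<sigma>)"
proof -
  have "two_perms N id X \<sigma>" using assms by (intro two_perms.intro finite_perm_id)
  then show ?thesis by (simp add: two_perms.card_Fix_lr_Sr card_cycles_id)
qed

section \<open>The fixed-point formulas and the theorem\<close>

lemma falling_fact_conv_binomial: "falling_fact m k = real ((m choose k) * fact k)"
proof -
  have "falling_fact m k = fact k * (real m gchoose k)"
    unfolding falling_fact_def gbinomial_mult_fact by (simp add: atLeast0LessThan)
  then show ?thesis by (simp add: binomial_gbinomial)
qed

context two_perms
begin

text \<open>
  The fixed points under a single permutation are obtained by taking the identity for the other
  one, whose cycle type is concentrated at length 1.
\<close>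

interpretation idN: two_perms N id X \<sigma>
  by (intro two_perms.intro finite_perm_id N.fin X.finite_perm_axioms)

interpretation idX: two_perms N \<pi> X id
  by (intro two_perms.intro finite_perm_id X.fin N.finite_perm_axioms)

lemma type_zero: "cycle_type N \<pi> 0 = 0" "cycle_type X \<sigma> 0 = 0"
  by (simp_all add: N.cycle_type_outside X.cycle_type_outside)

lemma real_card_Fix_l_relations:
  "real (card (Fix_l (relations N X) \<pi>)) = 2 ^ ((\<Sum>d=1..card N. cycle_type N \<pi> d) * card X)"
proof -
  have "(\<Sum>i=1..card N. \<Sum>j=1..card X. cycle_type N \<pi> i * cycle_type X id j * gcd i j) =
      (\<Sum>i=1..card N. cycle_type N \<pi> i * card X)"
  proof (rule sum.cong[OF refl])
    fix i
    have "(\<Sum>j=1..card X. cycle_type N \<pi> i * cycle_type X id j * gcd i j) =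
        (\<Sum>j=1..card X. if j = 1 then cycle_type N \<pi> i * card X else 0)"
      by (rule sum.cong) (simp_all add: cycle_type_id)
    also have "\<dots> = cycle_type N \<pi> i * card X" by (cases "card X = 0") (simp_all add: sum.delta)
    finally show "(\<Sum>j=1..card X. cycle_type N \<pi> i * cycle_type X id j * gcd i j) = cycle_type N \<pi> i * card X" .
  qed
  then show ?thesis
    unfolding Fix_l_altdef idX.card_Fix_lr_relations by (simp add: sum_distrib_right)
qed

lemma real_card_Fix_lr_relations:
  "real (card (Fix_lr (relations N X) \<pi> \<sigma>)) =
    2 ^ (\<Sum>i=1..card N. \<Sum>j=1..card X. cycle_type N \<pi> i * cycle_type X \<sigma> j * gcd i j)"
  unfolding card_Fix_lr_relations by simp

lemma real_card_Fix_l_Ir: "real (card (Fix_l (rel_Ir N X) \<pi>)) = (1 + real (cycle_type N \<pi> 1)) ^ card X"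
  unfolding Fix_l_altdef idX.card_Fix_lr_Ir cycle_type_id prod_at_one by simp

lemma real_card_Fix_r_Ir: "real (card (Fix_r (rel_Ir N X) \<sigma>)) = (1 + real (card N)) ^ (\<Sum>j=1..card X. cycle_type X \<sigma> j)"
proof -
  have "(\<Sum>d | d dvd k. d * cycle_type N id d) = card N" if "k \<in> {1..card X}" for k
  proof -
    have "(\<Sum>d | d dvd k. d * cycle_type N id d) = (\<Sum>d | d dvd k. if d = 1 then card N else 0)"
      by (rule sum.cong) (simp_all add: cycle_type_id)
    then show ?thesis using that by (simp add: sum.delta finite_divisors_nat)
  qed
  then have "card (Fix_r (rel_Ir N X) \<sigma>) = (\<Prod>k=1..card X. (1 + card N) ^ cycle_type X \<sigma> k)"
    unfolding Fix_r_altdef idN.card_Fix_lr_Ir by (intro prod.cong refl) simp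
  then show ?thesis by (simp add: power_sum)
qed

lemma real_card_Fix_lr_Ir:
  "real (card (Fix_lr (rel_Ir N X) \<pi> \<sigma>)) =
    (\<Prod>k=1..card X. (1 + (\<Sum>d | d dvd k. real d * real (cycle_type N \<pi> d))) ^ cycle_type X \<sigma> k)"
  unfolding card_Fix_lr_Ir by simp

lemma real_card_Fix_l_Sr:
  "real (card (Fix_l (rel_Sr N X) \<pi>)) = (2 ^ (\<Sum>i=1..card N. cycle_type N \<pi> i) - 1) ^ card X"
  unfolding Fix_l_altdef card_Fix_lr_Sr_id_right[OF N.finite_perm_axioms X.fin] N.card_cycles
  by (simp add: of_nat_diff)

lemma real_card_Fix_r_Sr:
  "real (card (Fix_r (rel_Sr N X) \<sigma>)) = (2 ^ card N - 1) ^ (\<Sum>j=1..card X. cycle_type X \<sigma> j)"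
  unfolding Fix_r_altdef card_Fix_lr_Sr_id_left[OF N.fin X.finite_perm_axioms] X.card_cycles
  by (simp add: of_nat_diff)

lemma real_card_Fix_lr_Ilr:
  "real (card (Fix_lr (rel_Ilr N X) \<pi> \<sigma>)) =
    (\<Prod>k=0..min (card N) (card X). \<Sum>i=0..min (cycle_type N \<pi> k) (cycle_type X \<sigma> k).
       real (cycle_type N \<pi> k choose i) * real (cycle_type X \<sigma> k choose i) * fact i * real k ^ i)"
proof -
  let ?g = "\<lambda>k. match_count False k (cycle_type N \<pi> k) (cycle_type X \<sigma> k)"
  \<comment> \<open>Only lengths up to both \<open>card N\<close> and \<open>card X\<close> occur on both sides, and length 0 occurs on neither.\<close>
  have trivial: "?g k = 1" if "cycle_type N \<pi> k = 0 \<or> cycle_type X \<sigma> k = 0" for k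
    using that by (auto simp: match_count_partial)
  have "card (Fix_lr (rel_Ilr N X) \<pi> \<sigma>) = (\<Prod>k=1..max (card N) (card X). ?g k)"
    by (rule card_Fix_lr_Ilr) simp_all
  also have "\<dots> = (\<Prod>k=0..max (card N) (card X). ?g k)"
  proof (rule prod.mono_neutral_left)
    show "\<forall>k\<in>{0..max (card N) (card X)} - {1..max (card N) (card X)}. ?g k = 1"
    proof
      fix k assume "k \<in> {0..max (card N) (card X)} - {1..max (card N) (card X)}"
      then have "k = 0" by (cases k) auto
      then show "?g k = 1" using trivial[of k] type_zero by simp
    qed
  qed auto
  also have "\<dots> = (\<Prod>k=0..min (card N) (card X). ?g k)"
  proof (rule prod.mono_neutral_right)
    show "\<forall>k\<in>{0..max (card N) (card X)} - {0..min (card N) (card X)}. ?g k = 1"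
    proof
      fix k assume "k \<in> {0..max (card N) (card X)} - {0..min (card N) (card X)}"
      then have "k \<notin> {1..card N} \<or> k \<notin> {1..card X}" by auto
      then show "?g k = 1" using trivial[of k] N.cycle_type_outside[of k] X.cycle_type_outside[of k] by argo
    qed
  qed auto
  finally show ?thesis by (simp add: match_count_partial)
qed

lemma real_card_Fix_l_Ilr:
  "real (card (Fix_l (rel_Ilr N X) \<pi>)) =
    (\<Sum>k=0..min (cycle_type N \<pi> 1) (card X). real (cycle_type N \<pi> 1 choose k) * falling_fact (card X) k)"
proof -
  let ?g = "\<lambda>k. match_count False k (cycle_type N \<pi> k) (cycle_type X id k)"
  \<comment> \<open>The successor ensures that the factor for length 1 is present even if both sets are empty.\<close>
  define m where "m = Suc (max (card N) (card X))"
  have m: "m \<ge> 1" by (simp add: m_def)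
  have "card (Fix_l (rel_Ilr N X) \<pi>) = (\<Prod>k=1..m. ?g k)"
    unfolding Fix_l_altdef by (rule idX.card_Fix_lr_Ilr) (simp_all add: m_def)
  also have "\<dots> = (\<Prod>k=1..m. if k = 1 then ?g 1 else 1)"
    by (rule prod.cong) (simp_all add: match_count_partial cycle_type_id)
  also have "\<dots> = ?g 1" using prod.delta[of "{1..m}" 1 "\<lambda>_. ?g 1"] m by simp
  finally show ?thesis
    by (simp add: match_count_partial cycle_type_id falling_fact_conv_binomial mult.assoc)
qed

lemma real_card_Fix_r_Ilr:
  "real (card (Fix_r (rel_Ilr N X) \<sigma>)) =
    (\<Sum>k=0..min (card N) (cycle_type X \<sigma> 1). real (cycle_type X \<sigma> 1 choose k) * falling_fact (card N) k)"
proof -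
  let ?g = "\<lambda>k. match_count False k (cycle_type N id k) (cycle_type X \<sigma> k)"
  \<comment> \<open>The successor ensures that the factor for length 1 is present even if both sets are empty.\<close>
  define m where "m = Suc (max (card N) (card X))"
  have m: "m \<ge> 1" by (simp add: m_def)
  have "card (Fix_r (rel_Ilr N X) \<sigma>) = (\<Prod>k=1..m. ?g k)"
    unfolding Fix_r_altdef by (rule idN.card_Fix_lr_Ilr) (simp_all add: m_def)
  also have "\<dots> = (\<Prod>k=1..m. if k = 1 then ?g 1 else 1)"
    by (rule prod.cong) (simp_all add: match_count_partial cycle_type_id)
  also have "\<dots> = ?g 1" using prod.delta[of "{1..m}" 1 "\<lambda>_. ?g 1"] m by simp
  finally show ?thesis
    by (simp add: match_count_partial cycle_type_id falling_fact_conv_binomial mult.assoc mult.left_commute)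
qed

lemma real_card_Fix_l_Slr:
  "real (card (Fix_l (rel_Slr N X) \<pi>)) =
    (let r = (\<Sum>i=1..card N. cycle_type N \<pi> i) in
     \<Sum>k=0..r. (- 1) ^ k * real (r choose k) * (2 ^ (r - k) - 1) ^ card X)"
proof -
  define r where "r = card (cycles N \<pi>)"
  have r: "r = (\<Sum>i=1..card N. cycle_type N \<pi> i)" unfolding r_def N.card_cycles ..
  have "card (Fix_lr (rel_Sr (N - \<Union>K) X) \<pi> id) = (2 ^ (r - card K) - 1) ^ card X"
    if K: "K \<in> Pow (cycles N \<pi>)" for K
  proof -
    have "K \<subseteq> cycles N \<pi>" using K by blast
    then show ?thesis
      unfolding card_Fix_lr_Sr_id_right[OF N.remove_cycles(1)[OF \<open>K \<subseteq> cycles N \<pi>\<close>] X.fin]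
        N.remove_cycles(2)[OF \<open>K \<subseteq> cycles N \<pi>\<close>]
      using N.cycles_finite by (simp add: card_Diff_subset finite_subset r_def)
  qed
  then have "real (card (Fix_l (rel_Slr N X) \<pi>)) =
      (\<Sum>K\<in>Pow (cycles N \<pi>). (- 1) ^ card K * (2 ^ (r - card K) - 1) ^ card X)"
    unfolding Fix_l_altdef idX.card_Fix_lr_Slr by (intro sum.cong refl) (simp add: of_nat_diff)
  also have "\<dots> = (\<Sum>k=0..r. of_nat (r choose k) * ((- 1) ^ k * (2 ^ (r - k) - 1) ^ card X))"
    unfolding r_def by (rule sum_over_Pow_card[OF N.cycles_finite])
  finally show ?thesis unfolding Let_def r[symmetric] by (simp add: mult_ac)
qed

lemma real_card_Fix_r_Slr:
  "real (card (Fix_r (rel_Slr N X) \<sigma>)) =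
    (let s = (\<Sum>j=1..card X. cycle_type X \<sigma> j) in
     \<Sum>k=0..card N. (- 1) ^ k * real (card N choose k) * (2 ^ (card N - k) - 1) ^ s)"
proof -
  define s where "s = card (cycles X \<sigma>)"
  have s: "s = (\<Sum>j=1..card X. cycle_type X \<sigma> j)" unfolding s_def X.card_cycles ..
  \<comment> \<open>Inclusion-exclusion runs over the cycles of the identity, that is over the single elements
    of \<open>N\<close>.\<close>
  have n: "card (cycles N id) = card N" by (simp add: card_cycles_id)
  have "card (Fix_lr (rel_Sr (N - \<Union>K) X) id \<sigma>) = (2 ^ (card N - card K) - 1) ^ s"
    if K: "K \<in> Pow (cycles N id)" for K
  proof -
    have K': "K \<subseteq> cycles N id" using K by blast
    have "card (N - \<Union>K) = card (cycles N id - K)"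
      using card_cycles_id[of "N - \<Union>K"] unfolding idN.N.remove_cycles(2)[OF K'] by simp
    also have "\<dots> = card N - card K"
      using idN.N.cycles_finite K' by (simp add: card_Diff_subset finite_subset n)
    finally show ?thesis
      using card_Fix_lr_Sr_id_left[OF _ X.finite_perm_axioms, of "N - \<Union>K"] N.fin
      by (simp add: s_def)
  qed
  then have "real (card (Fix_r (rel_Slr N X) \<sigma>)) =
      (\<Sum>K\<in>Pow (cycles N id). (- 1) ^ card K * (2 ^ (card N - card K) - 1) ^ s)"
    unfolding Fix_r_altdef idN.card_Fix_lr_Slr by (intro sum.cong refl) (simp add: of_nat_diff)
  also have "\<dots> = (\<Sum>k=0..card N. of_nat (card N choose k) * ((- 1) ^ k * (2 ^ (card N - k) - 1) ^ s))"
    using sum_over_Pow_card[OF idN.N.cycles_finite, of "\<lambda>k. (- 1) ^ k * (2 ^ (card N - k) - 1) ^ s"] unfolding n .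
  finally show ?thesis unfolding Let_def s[symmetric] by (simp add: mult_ac)
qed

end

theorem theorem9p2:
  fixes N :: "'a set" and X :: "'b set" and n x :: nat
  assumes "finite N" and "finite X" and "card N = n" and "card X = x"
  shows
    "(\<forall>T \<in> {relations N X, rel_Ir N X, rel_Sr N X, rel_Ilr N X, rel_Slr N X}.
        (\<exists>F. (\<forall>\<pi>. \<pi> permutes N \<longrightarrow> card (Fix_l T \<pi>) = F (cycle_type N \<pi>)) \<and>
             real (num_orbits_l N T) =
               (\<Sum>a\<in>cycle_types n. cycle_weight n a * real (F a))) \<and>
        (\<exists>F. (\<forall>\<sigma>. \<sigma> permutes X \<longrightarrow> card (Fix_r T \<sigma>) = F (cycle_type X \<sigma>)) \<and>
             real (num_orbits_r X T) =
               (\<Sum>b\<in>cycle_types x. cycle_weight x b * real (F b))) \<and>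
        (\<exists>F. (\<forall>\<pi> \<sigma>. \<pi> permutes N \<and> \<sigma> permutes X \<longrightarrow>
                  card (Fix_lr T \<pi> \<sigma>) = F (cycle_type N \<pi>) (cycle_type X \<sigma>)) \<and>
             real (num_orbits_lr N X T) =
               (\<Sum>a\<in>cycle_types n. \<Sum>b\<in>cycle_types x.
                  cycle_weight n a * cycle_weight x b * real (F a b)))) \<and>
     (real (num_orbits_l N (relations N X)) =
      (\<Sum>a\<in>cycle_types n. cycle_weight n a * 2 ^ ((\<Sum>d=1..n. a d) * x))) \<and>
     (real (num_orbits_lr N X (relations N X)) =
      (\<Sum>a\<in>cycle_types n. \<Sum>b\<in>cycle_types x.
         cycle_weight n a * cycle_weight x b *
         2 ^ (\<Sum>i=1..n. \<Sum>j=1..x. a i * b j * gcd i j))) \<and>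
     (real (num_orbits_l N (rel_Ir N X)) =
      (\<Sum>a\<in>cycle_types n. cycle_weight n a * (1 + real (a 1)) ^ x)) \<and>
     (real (num_orbits_l N (rel_Sr N X)) =
      (\<Sum>a\<in>cycle_types n. cycle_weight n a * (2 ^ (\<Sum>d=1..n. a d) - 1) ^ x)) \<and>
     (real (num_orbits_l N (rel_Ilr N X)) =
      (\<Sum>a\<in>cycle_types n. cycle_weight n a *
         (\<Sum>k=0..min (a 1) x. real (a 1 choose k) * falling_fact x k))) \<and>
     (\<forall>\<pi> \<sigma> a b.
      \<pi> permutes N \<and> \<sigma> permutes X \<and> a = cycle_type N \<pi> \<and> b = cycle_type X \<sigma> \<longrightarrow>
        real (card (Fix_r (rel_Ir N X) \<sigma>)) = (1 + real n) ^ (\<Sum>j=1..x. b j) \<and>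
        real (card (Fix_lr (rel_Ir N X) \<pi> \<sigma>)) =
          (\<Prod>k=1..x. (1 + (\<Sum>d | d dvd k. real d * real (a d))) ^ b k) \<and>
        real (card (Fix_l (rel_Sr N X) \<pi>)) = (2 ^ (\<Sum>i=1..n. a i) - 1) ^ x \<and>
        real (card (Fix_r (rel_Sr N X) \<sigma>)) = (2 ^ n - 1) ^ (\<Sum>j=1..x. b j) \<and>
        real (card (Fix_l (rel_Ilr N X) \<pi>)) =
          (\<Sum>k=0..min (a 1) x. real (a 1 choose k) * falling_fact x k) \<and>
        real (card (Fix_r (rel_Ilr N X) \<sigma>)) =
          (\<Sum>k=0..min n (b 1). real (b 1 choose k) * falling_fact n k) \<and>
        real (card (Fix_lr (rel_Ilr N X) \<pi> \<sigma>)) =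
          (\<Prod>k=0..min n x. \<Sum>i=0..min (a k) (b k).
             real (a k choose i) * real (b k choose i) * fact i * real k ^ i) \<and>
        (let r = (\<Sum>i=1..n. a i) in
         real (card (Fix_l (rel_Slr N X) \<pi>)) =
           (\<Sum>k=0..r. (- 1) ^ k * real (r choose k) * (2 ^ (r - k) - 1) ^ x)) \<and>
        (let s = (\<Sum>j=1..x. b j) in
         real (card (Fix_r (rel_Slr N X) \<sigma>)) =
           (\<Sum>k=0..n. (- 1) ^ k * real (n choose k) * (2 ^ (n - k) - 1) ^ s))) \<and>
     (real (num_orbits_r X (rel_Ir N X)) =
      (\<Sum>b\<in>cycle_types x. cycle_weight x b * (1 + real n) ^ (\<Sum>j=1..x. b j))) \<and>
     (real (num_orbits_lr N X (rel_Ir N X)) =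
      (\<Sum>a\<in>cycle_types n. \<Sum>b\<in>cycle_types x.
         cycle_weight n a * cycle_weight x b *
         (\<Prod>k=1..x. (1 + (\<Sum>d | d dvd k. real d * real (a d))) ^ b k))) \<and>
     (real (num_orbits_r X (rel_Sr N X)) =
      (\<Sum>b\<in>cycle_types x. cycle_weight x b * (2 ^ n - 1) ^ (\<Sum>j=1..x. b j))) \<and>
     (real (num_orbits_r X (rel_Ilr N X)) =
      (\<Sum>b\<in>cycle_types x. cycle_weight x b *
         (\<Sum>k=0..min n (b 1). real (b 1 choose k) * falling_fact n k))) \<and>
     (real (num_orbits_lr N X (rel_Ilr N X)) =
      (\<Sum>a\<in>cycle_types n. \<Sum>b\<in>cycle_types x.
         cycle_weight n a * cycle_weight x b *
         (\<Prod>k=0..min n x. \<Sum>i=0..min (a k) (b k).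
            real (a k choose i) * real (b k choose i) * fact i * real k ^ i))) \<and>
     (real (num_orbits_l N (rel_Slr N X)) =
      (\<Sum>a\<in>cycle_types n. cycle_weight n a *
         (let r = (\<Sum>i=1..n. a i) in
          \<Sum>k=0..r. (- 1) ^ k * real (r choose k) * (2 ^ (r - k) - 1) ^ x))) \<and>
     (real (num_orbits_r X (rel_Slr N X)) =
      (\<Sum>b\<in>cycle_types x. cycle_weight x b *
         (let s = (\<Sum>j=1..x. b j) in
          \<Sum>k=0..n. (- 1) ^ k * real (n choose k) * (2 ^ (n - k) - 1) ^ s)))"
proof -
  note n = assms(3)[symmetric] and x = assms(4)[symmetric]
  have tp: "two_perms N \<pi> X \<sigma>" if "\<pi> permutes N" "\<sigma> permutes X" for \<pi> \<sigma>
    using that assms(1,2) by (intro two_perms.intro finite_perm_permutes)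
  note tpl = tp[OF _ permutes_id] and tpr = tp[OF permutes_id]
  note SF = symmetric_families[OF assms(1,2)]
  have SFs: "symmetric_family N X (relations N X)" "symmetric_family N X (rel_Ir N X)"
    "symmetric_family N X (rel_Sr N X)" "symmetric_family N X (rel_Ilr N X)"
    "symmetric_family N X (rel_Slr N X)"
    by (simp_all add: SF)
  have classes: "\<forall>T \<in> {relations N X, rel_Ir N X, rel_Sr N X, rel_Ilr N X, rel_Slr N X}.
      (\<exists>F. (\<forall>\<pi>. \<pi> permutes N \<longrightarrow> card (Fix_l T \<pi>) = F (cycle_type N \<pi>)) \<and>
           real (num_orbits_l N T) = (\<Sum>a\<in>cycle_types n. cycle_weight n a * real (F a))) \<and>
      (\<exists>F. (\<forall>\<sigma>. \<sigma> permutes X \<longrightarrow> card (Fix_r T \<sigma>) = F (cycle_type X \<sigma>)) \<and>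
           real (num_orbits_r X T) = (\<Sum>b\<in>cycle_types x. cycle_weight x b * real (F b))) \<and>
      (\<exists>F. (\<forall>\<pi> \<sigma>. \<pi> permutes N \<and> \<sigma> permutes X \<longrightarrow>
                card (Fix_lr T \<pi> \<sigma>) = F (cycle_type N \<pi>) (cycle_type X \<sigma>)) \<and>
           real (num_orbits_lr N X T) =
             (\<Sum>a\<in>cycle_types n. \<Sum>b\<in>cycle_types x. cycle_weight n a * cycle_weight x b * real (F a b)))"
  proof
    fix T assume "T \<in> {relations N X, rel_Ir N X, rel_Sr N X, rel_Ilr N X, rel_Slr N X}"
    then interpret symmetric_family N X T by (rule SF)
    obtain F where F: "card (Fix_lr T \<pi> \<sigma>) = F (cycle_type N \<pi>) (cycle_type X \<sigma>)"
      if "\<pi> permutes N" "\<sigma> permutes X" for \<pi> \<sigma>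
      using card_Fix_lr_class_function by blast
    have l: "card (Fix_l T \<pi>) = F (cycle_type N \<pi>) (cycle_type X id)" if "\<pi> permutes N" for \<pi>
      unfolding Fix_l_altdef by (rule F[OF that permutes_id])
    have r: "card (Fix_r T \<sigma>) = F (cycle_type N id) (cycle_type X \<sigma>)" if "\<sigma> permutes X" for \<sigma>
      unfolding Fix_r_altdef by (rule F[OF permutes_id that])
    show "(\<exists>F. (\<forall>\<pi>. \<pi> permutes N \<longrightarrow> card (Fix_l T \<pi>) = F (cycle_type N \<pi>)) \<and>
           real (num_orbits_l N T) = (\<Sum>a\<in>cycle_types n. cycle_weight n a * real (F a))) \<and>
      (\<exists>F. (\<forall>\<sigma>. \<sigma> permutes X \<longrightarrow> card (Fix_r T \<sigma>) = F (cycle_type X \<sigma>)) \<and>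
           real (num_orbits_r X T) = (\<Sum>b\<in>cycle_types x. cycle_weight x b * real (F b))) \<and>
      (\<exists>F. (\<forall>\<pi> \<sigma>. \<pi> permutes N \<and> \<sigma> permutes X \<longrightarrow>
                card (Fix_lr T \<pi> \<sigma>) = F (cycle_type N \<pi>) (cycle_type X \<sigma>)) \<and>
           real (num_orbits_lr N X T) =
             (\<Sum>a\<in>cycle_types n. \<Sum>b\<in>cycle_types x. cycle_weight n a * cycle_weight x b * real (F a b)))"
      unfolding n x
    proof (intro conjI)
      show "\<exists>F. (\<forall>\<pi>. \<pi> permutes N \<longrightarrow> card (Fix_l T \<pi>) = F (cycle_type N \<pi>)) \<and>
          real (num_orbits_l N T) = (\<Sum>a\<in>cycle_types (card N). cycle_weight (card N) a * real (F a))"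
        by (rule exI[of _ "\<lambda>a. F a (cycle_type X id)"], intro conjI allI impI l num_orbits_l_eq) (simp_all add: l)
      show "\<exists>F. (\<forall>\<sigma>. \<sigma> permutes X \<longrightarrow> card (Fix_r T \<sigma>) = F (cycle_type X \<sigma>)) \<and>
          real (num_orbits_r X T) = (\<Sum>b\<in>cycle_types (card X). cycle_weight (card X) b * real (F b))"
        by (rule exI[of _ "\<lambda>b. F (cycle_type N id) b"], intro conjI allI impI r num_orbits_r_eq) (simp_all add: r)
      show "\<exists>F. (\<forall>\<pi> \<sigma>. \<pi> permutes N \<and> \<sigma> permutes X \<longrightarrow>
            card (Fix_lr T \<pi> \<sigma>) = F (cycle_type N \<pi>) (cycle_type X \<sigma>)) \<and>
          real (num_orbits_lr N X T) = (\<Sum>a\<in>cycle_types (card N). \<Sum>b\<in>cycle_types (card X).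
            cycle_weight (card N) a * cycle_weight (card X) b * real (F a b))"
        by (rule exI[of _ F], intro conjI allI impI num_orbits_lr_eq) (simp_all add: F)
    qed
  qed
  have fixed: "real (card (Fix_r (rel_Ir N X) \<sigma>)) = (1 + real n) ^ (\<Sum>j=1..x. b j) \<and>
      real (card (Fix_lr (rel_Ir N X) \<pi> \<sigma>)) =
        (\<Prod>k=1..x. (1 + (\<Sum>d | d dvd k. real d * real (a d))) ^ b k) \<and>
      real (card (Fix_l (rel_Sr N X) \<pi>)) = (2 ^ (\<Sum>i=1..n. a i) - 1) ^ x \<and>
      real (card (Fix_r (rel_Sr N X) \<sigma>)) = (2 ^ n - 1) ^ (\<Sum>j=1..x. b j) \<and>
      real (card (Fix_l (rel_Ilr N X) \<pi>)) =
        (\<Sum>k=0..min (a 1) x. real (a 1 choose k) * falling_fact x k) \<and>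
      real (card (Fix_r (rel_Ilr N X) \<sigma>)) =
        (\<Sum>k=0..min n (b 1). real (b 1 choose k) * falling_fact n k) \<and>
      real (card (Fix_lr (rel_Ilr N X) \<pi> \<sigma>)) =
        (\<Prod>k=0..min n x. \<Sum>i=0..min (a k) (b k).
           real (a k choose i) * real (b k choose i) * fact i * real k ^ i) \<and>
      (let r = (\<Sum>i=1..n. a i) in
       real (card (Fix_l (rel_Slr N X) \<pi>)) =
         (\<Sum>k=0..r. (- 1) ^ k * real (r choose k) * (2 ^ (r - k) - 1) ^ x)) \<and>
      (let s = (\<Sum>j=1..x. b j) in
       real (card (Fix_r (rel_Slr N X) \<sigma>)) =
         (\<Sum>k=0..n. (- 1) ^ k * real (n choose k) * (2 ^ (n - k) - 1) ^ s))"
    if "\<pi> permutes N \<and> \<sigma> permutes X \<and> a = cycle_type N \<pi> \<and> b = cycle_type X \<sigma>" for \<pi> \<sigma> a b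
  proof -
    have p: "\<pi> permutes N" "\<sigma> permutes X" and a: "a = cycle_type N \<pi>" and b: "b = cycle_type X \<sigma>"
      using that by blast+
    interpret two_perms N \<pi> X \<sigma> by (rule tp[OF p])
    show ?thesis
      unfolding a b n x Let_def
      by (intro conjI real_card_Fix_r_Ir real_card_Fix_lr_Ir real_card_Fix_l_Sr real_card_Fix_r_Sr
          real_card_Fix_l_Ilr real_card_Fix_r_Ilr real_card_Fix_lr_Ilr
          real_card_Fix_l_Slr[unfolded Let_def] real_card_Fix_r_Slr[unfolded Let_def])
  qed
  note l = symmetric_family.num_orbits_l_eq and r = symmetric_family.num_orbits_r_eq
    and lr = symmetric_family.num_orbits_lr_eq
  show ?thesis
  proof (intro conjI classes)
    show "\<forall>\<pi> \<sigma> a b.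
      \<pi> permutes N \<and> \<sigma> permutes X \<and> a = cycle_type N \<pi> \<and> b = cycle_type X \<sigma> \<longrightarrow>
        real (card (Fix_r (rel_Ir N X) \<sigma>)) = (1 + real n) ^ (\<Sum>j=1..x. b j) \<and>
        real (card (Fix_lr (rel_Ir N X) \<pi> \<sigma>)) =
          (\<Prod>k=1..x. (1 + (\<Sum>d | d dvd k. real d * real (a d))) ^ b k) \<and>
        real (card (Fix_l (rel_Sr N X) \<pi>)) = (2 ^ (\<Sum>i=1..n. a i) - 1) ^ x \<and>
        real (card (Fix_r (rel_Sr N X) \<sigma>)) = (2 ^ n - 1) ^ (\<Sum>j=1..x. b j) \<and>
        real (card (Fix_l (rel_Ilr N X) \<pi>)) =
          (\<Sum>k=0..min (a 1) x. real (a 1 choose k) * falling_fact x k) \<and>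
        real (card (Fix_r (rel_Ilr N X) \<sigma>)) =
          (\<Sum>k=0..min n (b 1). real (b 1 choose k) * falling_fact n k) \<and>
        real (card (Fix_lr (rel_Ilr N X) \<pi> \<sigma>)) =
          (\<Prod>k=0..min n x. \<Sum>i=0..min (a k) (b k).
             real (a k choose i) * real (b k choose i) * fact i * real k ^ i) \<and>
        (let r = (\<Sum>i=1..n. a i) in
         real (card (Fix_l (rel_Slr N X) \<pi>)) =
           (\<Sum>k=0..r. (- 1) ^ k * real (r choose k) * (2 ^ (r - k) - 1) ^ x)) \<and>
        (let s = (\<Sum>j=1..x. b j) in
         real (card (Fix_r (rel_Slr N X) \<sigma>)) =
           (\<Sum>k=0..n. (- 1) ^ k * real (n choose k) * (2 ^ (n - k) - 1) ^ s))"
      by (intro allI impI fixed)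
  qed (unfold n x,
    rule l[OF SFs(1)], erule two_perms.real_card_Fix_l_relations[OF tpl],
    rule lr[OF SFs(1)], erule (1) two_perms.real_card_Fix_lr_relations[OF tp],
    rule l[OF SFs(2)], erule two_perms.real_card_Fix_l_Ir[OF tpl],
    rule l[OF SFs(3)], erule two_perms.real_card_Fix_l_Sr[OF tpl],
    rule l[OF SFs(4)], erule two_perms.real_card_Fix_l_Ilr[OF tpl],
    rule r[OF SFs(2)], erule two_perms.real_card_Fix_r_Ir[OF tpr],
    rule lr[OF SFs(2)], erule (1) two_perms.real_card_Fix_lr_Ir[OF tp],
    rule r[OF SFs(3)], erule two_perms.real_card_Fix_r_Sr[OF tpr],
    rule r[OF SFs(4)], erule two_perms.real_card_Fix_r_Ilr[OF tpr],
    rule lr[OF SFs(4)], erule (1) two_perms.real_card_Fix_lr_Ilr[OF tp],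
    rule l[OF SFs(5)], erule two_perms.real_card_Fix_l_Slr[OF tpl],
    rule r[OF SFs(5)], erule two_perms.real_card_Fix_r_Slr[OF tpr])
qed

end
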